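(* For any smooth and decomposable Probabilistic Circuit (PC) $p(\mathbf{X})$ over variables $\mathbf{X}=\{X_i\}_i$ and any univariate weight functions $\{w_i(X_i)\}_i$, define $$p'(\mathbf{x}) = \frac{1}{Z}\prod_i w_i(x_i)\cdot p(\mathbf{x}),$$ where the normalizing constant is $Z := \sum_{\mathbf{x}} \prod_i w_i(x_i)\cdot p(\mathbf{x})$. Assume all variables in $\mathbf{X}$ are categorical variables with $C$ categories. Then the forward-backward algorithm described in the context computes $p'(x_i)$ (the univariate marginal of $p'$) for every variable $X_i$ and its every assignment $x_i$ in time $O(|p| + |\mathbf{X}|\cdot C) = O(|p|)$.
   Context: **Probabilistic Circuits.** A PC $p(\mathbf{X})$ represents a distribution over $\mathbf{X}$ via a parameterized directed acyclic graph (DAG) with a single root node $n_r$. Write $\mathrm{ch}(n)$ and $\mathrm{pa}(n)$ for the sets of children and parents of a node $n$. There are three types of nodes: input, product and sum nodes. Input nodes define primitive distributions over some variable $X\in\mathbf{X}$; sum and product nodes merge the distributions defined by their children. The distribution encoded by every node is defined recursively by $$p_n(\mathbf{x}) := \begin{cases} f_n(\mathbf{x}) & n \text{ is an input node},\\ \prod_{c\in\mathrm{ch}(n)} p_c(\mathbf{x}) & n \text{ is a product node},\\ \sum_{c\in\mathrm{ch}(n)} \theta_{n,c}\cdot p_c(\mathbf{x}) & n \text{ is a sum node},\end{cases}$$ where $f_n$ is a univariate input distribution (a distribution of the single variable of $n$) and $\theta_{n,c}$ is the parameter of the edge $(n,c)$. The parameters $\{\theta_{n,c}\}_{c\in\mathrm{ch}(n)}$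 of every sum node $n$ are assumed to sum to 1. The PC's distribution is that of its root: $p(\mathbf{x}) = p_{n_r}(\mathbf{x})$. The size $|p|$ of a PC $p$ is the number of edges in its DAG. **Smoothness and decomposability.** The scope $\phi(n)$ of a node $n$ is the collection of variables defined by all its descendant input nodes. A PC is smooth if for every sum node $n$ all children have the same scope: $\phi(c_1)=\phi(c_2)$ for all $c_1,c_2\in\mathrm{ch}(n)$. It is decomposable if for every product node $n$ the children have disjoint scopes: $\phi(c_1)\cap\phi(c_2)=\emptyset$ for all $c_1\neq c_2$ in $\mathrm{ch}(n)$. **The algorithm.** *Forward pass.* Traverse all nodes in postorder (children before parents) and store the output of every node $n$ in $\mathtt{fw}_n$. For an input node $n$ that encodes a distribution of $X_i$, $\mathtt{fw}_n := \sum_{x_i} f_n(x_i)\cdot w_i(x_i)$. For a product node, $\mathtt{fw}_n := \prod_{c\in\mathrm{ch}(n)}\mathtt{fw}_c$. For a sum node, $\mathtt{fw}_n := \sum_{c\in\mathrm{ch}(n)}\theta_{n,c}\cdot\mathtt{fw}_c$. *Backward pass.* For ease of presentation it is assumed that the PC alternates between sum and product layers and that all parents of any input node are product nodes. (Every PC that does not satisfy this can be transformed into one that does in linear time: consecutive sum or product nodes can be merged without changing the PC's semantics, and a dummy product node with one child can be added between any pair of sum and input nodes.) The pass has two steps. (i) Set $\mathtt{bk}_{n_r} := 1$ for the root node, then traverse the other nodes in preorder (parents before children) and recursively compute $$\mathtt{bk}_n := \begin{cases} \sum_{m\in\mathrm{pa}(n)} \big(\theta_{m,n}\cdot \mathtt{fw}_n/\mathtt{fw}_m\big)\cdot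 \mathtt{bk}_m & n \text{ is a product node},\\ \sum_{m\in\mathrm{pa}(n)} \mathtt{bk}_m & n \text{ is an input or sum node}.\end{cases}$$ (ii) For every $i$, gather the set $S_i$ of all input nodes defined on $X_i$, and compute $$p'(x_i) := \frac{1}{Z}\sum_{n\in S_i} \mathtt{bk}_n\cdot f_n(x_i)\cdot w_i(x_i).$$
   Formalization: Step (ii) is corrected: each summand is divided by fw_n instead of the sum by Z (the printed formula fails for a product of two inputs). Z≠0 is assumed, with weights nonnegative (0/0=0) or no fw_n zero. C is a constant: the O-constants may depend on C. *)

theory Defs
  imports
    Complex_Main
    "HOL-Library.FuncSet"
    "HOL-Library.Monad_Syntax"
    "HOL-Library.While_Combinator"
begin

section \<open>Probabilistic circuits\<close>

text \<open>
  A circuit is a heap of nodes addressed by natural numbers, together with the address of its root.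
  An input node carries its variable and its input distribution; a sum node carries its children
  and the parameters of its outgoing edges. The variables are \<open>X\<^sub>0, \<dots>, X\<^bsub>d-1\<^esub>\<close>, each with the
  categories \<open>0, \<dots>, C-1\<close>.
\<close>

datatype node =
    Input nat "nat \<Rightarrow> real"
  | Product "nat list"
  | Sum "nat list" "nat \<Rightarrow> real"

record pc =
  root_at :: nat
  node_at :: "nat \<Rightarrow> node"

fun children_of :: "node \<Rightarrow> nat list" where
  "children_of (Input i f) = []"
| "children_of (Product cs) = cs"
| "children_of (Sum cs \<theta>) = cs"

definition ch :: "pc \<Rightarrow> nat \<Rightarrow> nat set" where
  "ch P n = set (children_of (node_at P n))"

text \<open>
  The nodes of the circuit are the addresses reachable from the root. In a finite acyclic graph
  this says precisely that the root is the only node without a parent. Heap cells outside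
  \<open>nodes P\<close> are irrelevant.
\<close>

definition nodes :: "pc \<Rightarrow> nat set" where
  "nodes P = {n. (root_at P, n) \<in> {(m, c). c \<in> ch P m}\<^sup>*}"

definition edges :: "pc \<Rightarrow> (nat \<times> nat) set" where
  "edges P = {(m, c). m \<in> nodes P \<and> c \<in> ch P m}"

definition pc_size :: "pc \<Rightarrow> nat" where
  "pc_size P = card (edges P)"

definition scope :: "pc \<Rightarrow> nat \<Rightarrow> nat set" where
  "scope P n = {i. \<exists>m f. (n, m) \<in> (edges P)\<^sup>* \<and> node_at P m = Input i f}"

fun valid_node :: "nat \<Rightarrow> node \<Rightarrow> bool" where
  "valid_node C (Input i f) \<longleftrightarrow> (\<forall>v<C. 0 \<le> f v) \<and> (\<Sum>v<C. f v) = 1"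
| "valid_node C (Product cs) \<longleftrightarrow> distinct cs \<and> cs \<noteq> []"
| "valid_node C (Sum cs \<theta>) \<longleftrightarrow> distinct cs \<and> (\<forall>c\<in>set cs. 0 \<le> \<theta> c) \<and> (\<Sum>c\<in>set cs. \<theta> c) = 1"

text \<open>A circuit over the variables \<open>X\<^sub>0, \<dots>, X\<^bsub>d-1\<^esub>\<close>: the root has all of them in its scope.\<close>

definition is_pc :: "nat \<Rightarrow> nat \<Rightarrow> pc \<Rightarrow> bool" where
  "is_pc d C P \<longleftrightarrow>
     finite (nodes P) \<and> acyclic (edges P) \<and>
     (\<forall>n\<in>nodes P. valid_node C (node_at P n)) \<and>
     scope P (root_at P) = {..<d}"

definition smooth :: "pc \<Rightarrow> bool" where
  "smooth P \<longleftrightarrow>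
     (\<forall>n\<in>nodes P. \<forall>cs \<theta>. node_at P n = Sum cs \<theta> \<longrightarrow>
        (\<forall>c\<^sub>1\<in>ch P n. \<forall>c\<^sub>2\<in>ch P n. scope P c\<^sub>1 = scope P c\<^sub>2))"

definition decomposable :: "pc \<Rightarrow> bool" where
  "decomposable P \<longleftrightarrow>
     (\<forall>n\<in>nodes P. \<forall>cs. node_at P n = Product cs \<longrightarrow>
        (\<forall>c\<^sub>1\<in>ch P n. \<forall>c\<^sub>2\<in>ch P n. c\<^sub>1 \<noteq> c\<^sub>2 \<longrightarrow> scope P c\<^sub>1 \<inter> scope P c\<^sub>2 = {}))"

text \<open>
  Bottom-up evaluation, where an input node with variable \<open>i\<close> and distribution \<open>f\<close> has the value
  \<open>leaf i f\<close>. The recursion is well-founded on finite acyclic circuits.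
\<close>

definition node_value :: "(nat \<Rightarrow> (nat \<Rightarrow> real) \<Rightarrow> real) \<Rightarrow> pc \<Rightarrow> nat \<Rightarrow> real" where
  "node_value leaf P = wfrec ((edges P)\<inverse>) (\<lambda>rec n.
     case node_at P n of
       Input i f \<Rightarrow> leaf i f
     | Product cs \<Rightarrow> (\<Prod>c\<in>ch P n. rec c)
     | Sum cs \<theta> \<Rightarrow> (\<Sum>c\<in>ch P n. \<theta> c * rec c))"

lemma node_value_unfold:
  assumes "is_pc d C P" and "n \<in> nodes P"
  shows "node_value leaf P n =
    (case node_at P n of
       Input i f \<Rightarrow> leaf i f
     | Product cs \<Rightarrow> (\<Prod>c\<in>ch P n. node_value leaf P c)
     | Sum cs \<theta> \<Rightarrow> (\<Sum>c\<in>ch P n. \<theta> c * node_value leaf P c))"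
proof -
  have "edges P \<subseteq> nodes P \<times> nodes P"
    unfolding edges_def nodes_def by (auto intro: rtrancl_into_rtrancl)
  then have "finite (edges P)"
    using assms(1) unfolding is_pc_def by (meson finite_SigmaI finite_subset)
  then have wf: "wf ((edges P)\<inverse>)"
    using assms(1) unfolding is_pc_def by (simp add: finite_acyclic_wf_converse)
  have cut: "cut h ((edges P)\<inverse>) n c = h c" if "c \<in> ch P n" for h :: "nat \<Rightarrow> real" and c
    using that assms(2) by (auto simp: cut_def edges_def)
  show ?thesis
    unfolding node_value_def
    by (subst wfrec[OF wf]) (auto split: node.split simp: cut intro!: prod.cong sum.cong)
qed

definition prob :: "pc \<Rightarrow> (nat \<Rightarrow> nat) \<Rightarrow> real" where
  "prob P x = node_value (\<lambda>i f. f (x i)) P (root_at P)"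

section \<open>The reweighted distribution\<close>

definition assignments :: "nat \<Rightarrow> nat \<Rightarrow> (nat \<Rightarrow> nat) set" where
  "assignments d C = {..<d} \<rightarrow>\<^sub>E {..<C}"

definition norm_const :: "nat \<Rightarrow> nat \<Rightarrow> (nat \<Rightarrow> nat \<Rightarrow> real) \<Rightarrow> pc \<Rightarrow> real" where
  "norm_const d C w P = (\<Sum>x\<in>assignments d C. (\<Prod>i<d. w i (x i)) * prob P x)"

definition reweighted :: "nat \<Rightarrow> nat \<Rightarrow> (nat \<Rightarrow> nat \<Rightarrow> real) \<Rightarrow> pc \<Rightarrow> (nat \<Rightarrow> nat) \<Rightarrow> real" where
  "reweighted d C w P x = 1 / norm_const d C w P * (\<Prod>i<d. w i (x i)) * prob P x"

definition marginal ::
    "nat \<Rightarrow> nat \<Rightarrow> ((nat \<Rightarrow> nat) \<Rightarrow> real) \<Rightarrow> nat \<Rightarrow> nat \<Rightarrow> real" where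
  "marginal d C q i v = (\<Sum>x\<in>{x \<in> assignments d C. x i = v}. q x)"

text \<open>The value that the forward pass is to store in \<open>fw\<^sub>n\<close>.\<close>

definition fw_value :: "nat \<Rightarrow> (nat \<Rightarrow> nat \<Rightarrow> real) \<Rightarrow> pc \<Rightarrow> nat \<Rightarrow> real" where
  "fw_value C w P = node_value (\<lambda>i f. \<Sum>v<C. f v * w i v) P"

section \<open>Programs with running time\<close>

text \<open>
  Unit-cost random access machine over the reals. \<open>op e\<close> charges one unit and is used for a single
  elementary operation: an arithmetic operation or comparison on reals or addresses, reading or
  writing one array cell or one field of a node, or one operation at the head of a list. Arrays are
  functions, updated with \<open>f(a := b)\<close>; allocating a constant array is charged one unit, as usual
  for the (lazily initialised) attributes of graph nodes. Loops charge one unit for each test of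
  the loop condition; \<open>ret\<close> and pairing are free.
\<close>

datatype 'a tm = TM (val: 'a) (time: nat)

definition bind_tm :: "'a tm \<Rightarrow> ('a \<Rightarrow> 'b tm) \<Rightarrow> 'b tm" where
  "bind_tm m k = (case m of TM a s \<Rightarrow> case k a of TM b t \<Rightarrow> TM b (s + t))"

adhoc_overloading Monad_Syntax.bind \<rightleftharpoons> bind_tm

definition ret :: "'a \<Rightarrow> 'a tm" where
  "ret a = TM a 0"

definition op :: "'a \<Rightarrow> 'a tm" where
  "op a = TM a 1"

fun for_each :: "'a list \<Rightarrow> ('a \<Rightarrow> 's \<Rightarrow> 's tm) \<Rightarrow> 's \<Rightarrow> 's tm" where
  "for_each [] body s = op s"
| "for_each (a # as) body s = do { s' \<leftarrow> op s; s'' \<leftarrow> body a s'; for_each as body s'' }"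

text \<open>
  \<^const>\<open>while\<close> also iterates the clock here; on a diverging loop both components of the result are
  unspecified.
\<close>

definition while_loop :: "('s \<Rightarrow> bool) \<Rightarrow> ('s \<Rightarrow> 's tm) \<Rightarrow> 's \<Rightarrow> 's tm" where
  "while_loop b body s =
     (case while (\<lambda>(s, t). b s)
             (\<lambda>(s, t). case body s of TM s' t' \<Rightarrow> (s', t + 1 + t')) (s, 0) of
        (s', t) \<Rightarrow> TM s' (t + 1))"

section \<open>The forward-backward algorithm\<close>

text \<open>
  Depth-first search from the root with an explicit stack of (node, children still to be explored);
  the state also has the set of visited nodes as an array of marks, and the list of finished nodes,
  last finished first. Hence the result lists parents before children, and its reverse is a
  postorder.
\<close>

definition preorder :: "pc \<Rightarrow> nat list tm" where
  "preorder P = do {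
     r \<leftarrow> op (root_at P);
     cs \<leftarrow> op (children_of (node_at P r));
     vis \<leftarrow> op (\<lambda>_. False);
     vis \<leftarrow> op (vis(r := True));
     (_, _, ord) \<leftarrow> while_loop (\<lambda>(stack, vis, ord). stack \<noteq> [])
       (\<lambda>(stack, vis, ord). case stack of
          [] \<Rightarrow> ret (stack, vis, ord)
        | (n, []) # stack' \<Rightarrow> do {
            ord' \<leftarrow> op (n # ord);
            ret (stack', vis, ord')
          }
        | (n, c # cs) # stack' \<Rightarrow> do {
            seen \<leftarrow> op (vis c);
            if seen then op ((n, cs) # stack', vis, ord)
            else do {
              vis' \<leftarrow> op (vis(c := True));
              ds \<leftarrow> op (children_of (node_at P c));
              stack'' \<leftarrow> op ((n, cs) # stack');
              op ((c, ds) # stack'', vis', ord)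
            }
          })
       ([(r, cs)], vis, []);
     ret ord
   }"

definition rev_tm :: "'a list \<Rightarrow> 'a list tm" where
  "rev_tm xs = for_each xs (\<lambda>x ys. op (x # ys)) []"

definition forward_node ::
    "nat \<Rightarrow> (nat \<Rightarrow> nat \<Rightarrow> real) \<Rightarrow> pc \<Rightarrow> (nat \<Rightarrow> real) \<Rightarrow> nat \<Rightarrow> real tm" where
  "forward_node C w P fw n = do {
     k \<leftarrow> op (node_at P n);
     case k of
       Input i f \<Rightarrow> for_each [0..<C] (\<lambda>v s. do {
           a \<leftarrow> op (f v);
           b \<leftarrow> op (w i v);
           t \<leftarrow> op (a * b);
           op (s + t)
         }) 0
     | Product cs \<Rightarrow> for_each cs (\<lambda>c s. do {
           a \<leftarrow> op (fw c);
           op (s * a)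
         }) 1
     | Sum cs \<theta> \<Rightarrow> for_each cs (\<lambda>c s. do {
           a \<leftarrow> op (\<theta> c);
           b \<leftarrow> op (fw c);
           t \<leftarrow> op (a * b);
           op (s + t)
         }) 0
   }"

definition forward_pass ::
    "nat \<Rightarrow> (nat \<Rightarrow> nat \<Rightarrow> real) \<Rightarrow> pc \<Rightarrow> nat list \<Rightarrow> (nat \<Rightarrow> real) tm" where
  "forward_pass C w P post = do {
     fw\<^sub>0 \<leftarrow> op (\<lambda>_. 0);
     for_each post (\<lambda>n fw. do {
       v \<leftarrow> forward_node C w P fw n;
       op (fw(n := v))
     }) fw\<^sub>0
   }"

definition parent_lists :: "pc \<Rightarrow> nat list \<Rightarrow> (nat \<Rightarrow> nat list) tm" where
  "parent_lists P ord = do {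
     par\<^sub>0 \<leftarrow> op (\<lambda>_. []);
     for_each ord (\<lambda>m par. do {
       cs \<leftarrow> op (children_of (node_at P m));
       for_each cs (\<lambda>c par. do {
         ms \<leftarrow> op (par c);
         ms' \<leftarrow> op (m # ms);
         op (par(c := ms'))
       }) par
     }) par\<^sub>0
   }"

fun param :: "node \<Rightarrow> nat \<Rightarrow> real" where
  "param (Sum cs \<theta>) c = \<theta> c"
| "param _ c = 0"

text \<open>
  In an alternating circuit every parent of a product node is a sum node, so \<^const>\<open>param\<close> is only
  read where it is \<open>\<theta>\<^bsub>m,n\<^esub>\<close>. A quotient \<open>0 / 0\<close> evaluates to \<open>0\<close>.
\<close>

definition backward_node ::
    "pc \<Rightarrow> (nat \<Rightarrow> real) \<Rightarrow> (nat \<Rightarrow> nat list) \<Rightarrow> (nat \<Rightarrow> real) \<Rightarrow> nat \<Rightarrow> real tm" where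
  "backward_node P fw par bk n = do {
     ms \<leftarrow> op (par n);
     k \<leftarrow> op (node_at P n);
     case k of
       Product cs \<Rightarrow> for_each ms (\<lambda>m s. do {
           km \<leftarrow> op (node_at P m);
           a \<leftarrow> op (param km n);
           fn \<leftarrow> op (fw n);
           fm \<leftarrow> op (fw m);
           b \<leftarrow> op (bk m);
           t \<leftarrow> op (a * fn);
           t \<leftarrow> op (t / fm);
           t \<leftarrow> op (t * b);
           op (s + t)
         }) 0
     | _ \<Rightarrow> for_each ms (\<lambda>m s. do {
           b \<leftarrow> op (bk m);
           op (s + b)
         }) 0
   }"

definition backward_pass ::
    "pc \<Rightarrow> (nat \<Rightarrow> real) \<Rightarrow> (nat \<Rightarrow> nat list) \<Rightarrow> nat list \<Rightarrow> (nat \<Rightarrow> real) tm" where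
  "backward_pass P fw par ord = do {
     bk\<^sub>0 \<leftarrow> op (\<lambda>_. 0);
     for_each ord (\<lambda>n bk. do {
       is_root \<leftarrow> op (n = root_at P);
       v \<leftarrow> (if is_root then op 1 else backward_node P fw par bk n);
       op (bk(n := v))
     }) bk\<^sub>0
   }"

text \<open>The lists \<open>S\<^sub>i\<close> of the input nodes defined on \<open>X\<^sub>i\<close>.\<close>

definition gather_inputs :: "pc \<Rightarrow> nat list \<Rightarrow> (nat \<Rightarrow> nat list) tm" where
  "gather_inputs P ord = do {
     S\<^sub>0 \<leftarrow> op (\<lambda>_. []);
     for_each ord (\<lambda>n S. do {
       k \<leftarrow> op (node_at P n);
       case k of
         Input i f \<Rightarrow> do {
           ns \<leftarrow> op (S i);
           ns' \<leftarrow> op (n # ns);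
           op (S(i := ns'))
         }
       | _ \<Rightarrow> ret S
     }) S\<^sub>0
   }"

fun input_dist :: "node \<Rightarrow> nat \<Rightarrow> real" where
  "input_dist (Input i f) v = f v"
| "input_dist _ v = 0"

text \<open>
  The output is \<open>\<Sum>n\<in>S\<^sub>i. bk\<^sub>n * f\<^sub>n(v) * w\<^sub>i(v) / fw\<^sub>n\<close>. The factor \<open>1 / fw\<^sub>n\<close> normalises
  \<open>f\<^sub>n * w\<^sub>i\<close> for each input node separately. A common factor \<open>1 / Z\<close> in front of
  \<open>\<Sum>n\<in>S\<^sub>i. bk\<^sub>n * f\<^sub>n(v) * w\<^sub>i(v)\<close> does not give the marginals: for one product node over
  input nodes for \<open>X\<^sub>0\<close> and \<open>X\<^sub>1\<close>, all \<open>bk\<close> are \<open>1\<close> and \<open>Z = fw\<^sub>0 * fw\<^sub>1\<close>, whereas the marginal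
  of \<open>X\<^sub>0\<close> is \<open>f\<^sub>0 * w\<^sub>0 / fw\<^sub>0\<close>. Nor does any other common factor: for a sum node with both
  parameters \<open>1/2\<close> over (products of) two input nodes for \<open>X\<^sub>0\<close> with \<open>fw\<close> equal to \<open>1\<close> and \<open>2\<close>,
  the values of \<open>bk\<close> are \<open>1/3\<close> and \<open>2/3\<close>, but both input nodes contribute to the marginal with
  the same weight \<open>bk\<^sub>n / fw\<^sub>n = 1/3\<close>.
\<close>

definition read_out ::
    "nat \<Rightarrow> nat \<Rightarrow> (nat \<Rightarrow> nat \<Rightarrow> real) \<Rightarrow> pc \<Rightarrow> (nat \<Rightarrow> real) \<Rightarrow> (nat \<Rightarrow> real) \<Rightarrow>
     (nat \<Rightarrow> nat list) \<Rightarrow> (nat \<Rightarrow> nat \<Rightarrow> real) tm" where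
  "read_out d C w P fw bk S = do {
     R\<^sub>0 \<leftarrow> op (\<lambda>_ _. 0);
     for_each [0..<d] (\<lambda>i R. for_each [0..<C] (\<lambda>v R. do {
       ns \<leftarrow> op (S i);
       s \<leftarrow> for_each ns (\<lambda>n s. do {
         k \<leftarrow> op (node_at P n);
         b \<leftarrow> op (bk n);
         a \<leftarrow> op (input_dist k v);
         c \<leftarrow> op (w i v);
         z \<leftarrow> op (fw n);
         t \<leftarrow> op (b * a);
         t \<leftarrow> op (t * c);
         t \<leftarrow> op (t / z);
         op (s + t)
       }) 0;
       op (R(i := (R i)(v := s)))
     }) R) R\<^sub>0
   }"

definition forward_backward ::
    "nat \<Rightarrow> nat \<Rightarrow> (nat \<Rightarrow> nat \<Rightarrow> real) \<Rightarrow> pc \<Rightarrow> (nat \<Rightarrow> nat \<Rightarrow> real) tm" where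
  "forward_backward d C w P = do {
     ord \<leftarrow> preorder P;
     post \<leftarrow> rev_tm ord;
     fw \<leftarrow> forward_pass C w P post;
     par \<leftarrow> parent_lists P ord;
     bk \<leftarrow> backward_pass P fw par ord;
     S \<leftarrow> gather_inputs P ord;
     read_out d C w P fw bk S
   }"

section \<open>Circuits that do not alternate\<close>

text \<open>Edges from the first to the second node that an alternating circuit may not have.\<close>

fun clash :: "node \<Rightarrow> node \<Rightarrow> bool" where
  "clash (Sum _ _) (Sum _ _) = True"
| "clash (Sum _ _) (Input _ _) = True"
| "clash (Product _) (Product _) = True"
| "clash _ _ = False"

definition alternating :: "pc \<Rightarrow> bool" where
  "alternating P \<longleftrightarrow> (\<forall>(m, n)\<in>edges P. \<not> clash (node_at P m) (node_at P n))"

text \<open>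
  Node \<open>n\<close> moves to address \<open>2 * n\<close>. All clashing edges into \<open>n\<close> are redirected to a dummy node at
  address \<open>2 * n + 1\<close> that has \<open>n\<close> as its only child. (Merging adjacent sum or product nodes
  instead can multiply the number of edges when the lower node has several parents.)
\<close>

definition dummy :: "nat \<Rightarrow> node \<Rightarrow> node" where
  "dummy n' k = (case k of Product _ \<Rightarrow> Sum [n'] (\<lambda>_. 1) | _ \<Rightarrow> Product [n'])"

definition link ::
    "pc \<Rightarrow> node \<Rightarrow> nat \<Rightarrow> (nat \<Rightarrow> node) \<Rightarrow> (nat \<times> (nat \<Rightarrow> node)) tm" where
  "link P k c M = do {
     kc \<leftarrow> op (node_at P c);
     c' \<leftarrow> op (2 * c);
     bad \<leftarrow> op (clash k kc);
     if bad then do {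
       c'' \<leftarrow> op (c' + 1);
       D \<leftarrow> op (dummy c' kc);
       M' \<leftarrow> op (M(c'' := D));
       ret (c'', M')
     } else ret (c', M)
   }"

definition make_alternating :: "pc \<Rightarrow> pc tm" where
  "make_alternating P = do {
     ord \<leftarrow> preorder P;
     M\<^sub>0 \<leftarrow> op (\<lambda>_. Product []);
     M \<leftarrow> for_each ord (\<lambda>n M. do {
       k \<leftarrow> op (node_at P n);
       n' \<leftarrow> op (2 * n);
       case k of
         Input i f \<Rightarrow> op (M(n' := k))
       | Product cs \<Rightarrow> do {
           (cs', M') \<leftarrow> for_each cs (\<lambda>c (cs', M). do {
             (c', M') \<leftarrow> link P k c M;
             cs'' \<leftarrow> op (c' # cs');
             ret (cs'', M')
           }) ([], M);
           op (M'(n' := Product cs'))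
         }
       | Sum cs \<theta> \<Rightarrow> do {
           \<theta>\<^sub>0 \<leftarrow> op (\<lambda>_. 0);
           (cs', \<theta>', M') \<leftarrow> for_each cs (\<lambda>c (cs', \<theta>', M). do {
             (c', M') \<leftarrow> link P k c M;
             cs'' \<leftarrow> op (c' # cs');
             a \<leftarrow> op (\<theta> c);
             \<theta>'' \<leftarrow> op (\<theta>'(c' := a));
             ret (cs'', \<theta>'', M')
           }) ([], \<theta>\<^sub>0, M);
           op (M'(n' := Sum cs' \<theta>'))
         }
     }) M\<^sub>0;
     r \<leftarrow> op (root_at P);
     r' \<leftarrow> op (2 * r);
     op \<lparr>root_at = r', node_at = M\<rparr>
   }"

definition forward_backward_any ::
    "nat \<Rightarrow> nat \<Rightarrow> (nat \<Rightarrow> nat \<Rightarrow> real) \<Rightarrow> pc \<Rightarrow> (nat \<Rightarrow> nat \<Rightarrow> real) tm" where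
  "forward_backward_any d C w P = do {
     P' \<leftarrow> make_alternating P;
     forward_backward d C w P'
   }"

end

theory Submission
  imports Defs
begin

text \<open>
  Fix \<open>X\<^sub>i\<close> and \<open>v\<close>, and let \<open>F\<^sub>n\<close> be the forward value of \<open>n\<close> after replacing \<open>w\<^sub>i\<close> by its
  restriction to \<open>v\<close>. Smoothness and decomposability make the summation over all assignments commute
  with the evaluation of the circuit, so \<open>Z\<close> is the forward value of the root and the marginal is
  \<open>F / fw\<close> at the root. Put \<open>R\<^sub>n = F\<^sub>n / fw\<^sub>n\<close>. For every inner node \<open>m\<close> with \<open>X\<^sub>i\<close> in its scope,
  the parts of \<open>bk\<^sub>m\<close> that \<open>m\<close> passes to its children with \<open>X\<^sub>i\<close> in their scope, weighted by their
  \<open>R\<^sub>c\<close>, add up to \<open>bk\<^sub>m * R\<^sub>m\<close>: for a sum node these are all children, for a product node there is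
  exactly one, and the other factors cancel in \<open>R\<^sub>m\<close>. Summing the backward recursion over
  all nodes with \<open>X\<^sub>i\<close> in their scope therefore telescopes to
  \<open>\<Sum>n\<in>S\<^sub>i. bk\<^sub>n * R\<^sub>n = R\<close> at the root, and the left-hand side is the output of the algorithm.
  A vanishing \<open>fw\<^sub>n\<close> is harmless, because then \<open>F\<^sub>n = 0\<close> (weights are
  non-negative in this case, hence \<open>0 \<le> F\<^sub>n \<le> fw\<^sub>n\<close>), and \<open>bk\<^sub>n = 0\<close> if
  \<open>n\<close> is a product node.
\<close>

section \<open>Values and running times of programs\<close>

lemma val_bind [simp]: "val (bind_tm m k) = val (k (val m))"
  by (simp add: bind_tm_def split: tm.split)

lemma time_bind [simp]: "time (bind_tm m k) = time m + time (k (val m))"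
  by (simp add: bind_tm_def split: tm.split)

lemma val_ret [simp]: "val (ret a) = a" and time_ret [simp]: "time (ret a) = 0"
  by (simp_all add: ret_def)

lemma val_op [simp]: "val (op a) = a" and time_op [simp]: "time (op a) = 1"
  by (simp_all add: op_def)

lemma val_for_each [simp]: "val (for_each xs body s) = fold (\<lambda>a s. val (body a s)) xs s"
  by (induction xs arbitrary: s) simp_all

text \<open>Besides the body, \<open>for_each\<close> pays one unit for each element it takes off
  the list and one for finding the list empty.\<close>

lemma time_for_each:
  assumes "\<And>a s. a \<in> set xs \<Longrightarrow> time (body a s) \<le> T a"
  shows "time (for_each xs body s) \<le> 1 + (\<Sum>a\<leftarrow>xs. T a + 1)"
  using assms
proof (induction xs arbitrary: s)
  case (Cons x xs)
  have "time (body x s) \<le> T x"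
    using Cons.prems by simp
  moreover have "time (for_each xs body (val (body x s))) \<le> 1 + (\<Sum>a\<leftarrow>xs. T a + 1)"
    using Cons by simp
  ultimately show ?case
    by simp
qed simp

lemma time_for_each_const:
  assumes "\<And>a s. a \<in> set xs \<Longrightarrow> time (body a s) \<le> t"
  shows "time (for_each xs body s) \<le> 1 + (t + 1) * length xs"
proof -
  have "time (for_each xs body s) \<le> 1 + (\<Sum>a\<leftarrow>xs. t + 1)"
    by (rule time_for_each) (rule assms)
  then show ?thesis
    by (simp add: sum_list_triv mult.commute)
qed

text \<open>The potential \<open>pot\<close> pays for the body and the test of every iteration. As
  the test alone costs one unit, the potential strictly decreases and the loop terminates, so that
  \<open>while\<close> is specified. The extra unit pays for the last, failing test.\<close>

lemma while_loop_rule: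
  assumes "I s"
    and step: "\<And>s. I s \<Longrightarrow> b s \<Longrightarrow>
      I (val (body s)) \<and> time (body s) + 1 + pot (val (body s)) \<le> (pot s :: nat)"
  shows "I (val (while_loop b body s)) \<and> \<not> b (val (while_loop b body s)) \<and>
    time (while_loop b body s) \<le> pot s + 1"
proof -
  define w where "w = while (\<lambda>(s, t). b s)
    (\<lambda>(s, t). case body s of TM s' t' \<Rightarrow> (s', t + 1 + t')) (s, 0)"
  have "case w of (s', t) \<Rightarrow> I s' \<and> \<not> b s' \<and> t + pot s' \<le> pot s"
    unfolding w_def
  proof (rule while_rule[where P = "\<lambda>(s', t). I s' \<and> t + pot s' \<le> pot s"
        and r = "measure (pot \<circ> fst)"], goal_cases)
    case (2 st)
    then show ?case using step[of "fst st"] by (cases "body (fst st)") auto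
  next
    case (5 st)
    then show ?case using step[of "fst st"] by (cases "body (fst st)") auto
  qed (use assms in auto)
  then show ?thesis
    by (auto simp: while_loop_def w_def[symmetric] split: prod.splits)
qed

section \<open>Accumulating and array-writing folds\<close>

lemma fold_plus_eq_sum:
  fixes g :: "'a \<Rightarrow> real"
  assumes "distinct xs"
  shows "fold (\<lambda>x s. s + g x) xs a = a + (\<Sum>x\<in>set xs. g x)"
  using assms by (induction xs arbitrary: a) simp_all

lemma fold_times_eq_prod:
  fixes g :: "'a \<Rightarrow> real"
  assumes "distinct xs"
  shows "fold (\<lambda>x s. s * g x) xs a = a * (\<Prod>x\<in>set xs. g x)"
  using assms by (induction xs arbitrary: a) simp_all

text \<open>Persistence of array cells: in the backward pass an entry is final once its node has
  been processed, because no node occurs twice.\<close>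

lemma fold_upd_notin: "m \<notin> set xs \<Longrightarrow> fold (\<lambda>n f. f(n := g n f)) xs f m = f m"
  by (induction xs arbitrary: f) auto

section \<open>Circuits\<close>

lemma root_in_nodes: "root_at P \<in> nodes P"
  by (simp add: nodes_def)

lemma ch_in_nodes: "m \<in> nodes P \<Longrightarrow> c \<in> ch P m \<Longrightarrow> c \<in> nodes P"
  by (auto simp: nodes_def intro: rtrancl_into_rtrancl)

lemma edges_iff: "(m, c) \<in> edges P \<longleftrightarrow> m \<in> nodes P \<and> c \<in> ch P m"
  by (simp add: edges_def)

lemma edges_eq_Sigma: "edges P = (SIGMA m:nodes P. ch P m)"
  by (auto simp: edges_def)

lemma finite_ch: "finite (ch P n)"
  by (simp add: ch_def)

lemma nodes_induct [consumes 1, case_names root child]: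
  assumes "n \<in> nodes P" "Q (root_at P)"
    and "\<And>m c. m \<in> nodes P \<Longrightarrow> Q m \<Longrightarrow> c \<in> ch P m \<Longrightarrow> Q c"
  shows "Q n"
proof -
  have "(root_at P, n) \<in> {(m, c). c \<in> ch P m}\<^sup>*"
    using assms(1) by (simp add: nodes_def)
  then have "n \<in> nodes P \<and> Q n"
    by (induction rule: rtrancl_induct) (auto simp: assms root_in_nodes intro: assms(3) ch_in_nodes)
  then show ?thesis ..
qed

lemma nodes_eq: "nodes P = insert (root_at P) (\<Union>n\<in>nodes P. ch P n)"
proof -
  have "n \<in> nodes P \<Longrightarrow> n \<in> insert (root_at P) (\<Union>n\<in>nodes P. ch P n)" for n
    by (induction rule: nodes_induct) auto
  then show ?thesis
    using root_in_nodes ch_in_nodes by blast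
qed

text \<open>A path is split at its first edge: the empty path contributes the variable of
  \<open>n\<close> itself, and every other path starts with a child. Input nodes have no children
  and inner nodes carry no variable.\<close>

lemma scope_unfold:
  assumes "n \<in> nodes P"
  shows "scope P n = (case node_at P n of Input i f \<Rightarrow> {i} | _ \<Rightarrow> \<Union>c\<in>ch P n. scope P c)"
proof -
  have step: "(n, m) \<in> (edges P)\<^sup>* \<longleftrightarrow> m = n \<or> (\<exists>c\<in>ch P n. (c, m) \<in> (edges P)\<^sup>*)" for m
    by (metis (full_types) assms converse_rtranclE converse_rtrancl_into_rtrancl edges_iff rtrancl.rtrancl_refl)
  have "i \<in> scope P n \<longleftrightarrow> (\<exists>f. node_at P n = Input i f) \<or> (\<exists>c\<in>ch P n. i \<in> scope P c)" for i
    unfolding scope_def mem_Collect_eq step by blast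
  then show ?thesis
    by (cases "node_at P n") (auto simp: ch_def)
qed

locale circuit =
  fixes d C :: nat and P :: pc
  assumes is_pc: "is_pc d C P"
begin

lemma finite_nodes: "finite (nodes P)"
  and acyclic_edges: "acyclic (edges P)"
  and scope_root: "scope P (root_at P) = {..<d}"
  using is_pc by (auto simp: is_pc_def)

lemma valid_node: "n \<in> nodes P \<Longrightarrow> valid_node C (node_at P n)"
  using is_pc by (simp add: is_pc_def)

lemma finite_edges: "finite (edges P)"
  by (simp add: edges_eq_Sigma finite_nodes finite_ch)

lemma edges_subset: "edges P \<subseteq> nodes P \<times> nodes P"
  by (auto simp: edges_iff ch_in_nodes)

lemma wf_edges_converse: "wf ((edges P)\<inverse>)"
  by (simp add: finite_acyclic_wf_converse finite_edges acyclic_edges)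

text \<open>Bottom-up induction along the converse edges, which are well-founded because the circuit
  is finite and acyclic; \<open>nodes_induct\<close> proceeds from the root downwards
  instead.\<close>

lemma node_induct [consumes 1, case_names node]:
  assumes "n \<in> nodes P"
    and "\<And>n. n \<in> nodes P \<Longrightarrow> (\<And>c. c \<in> ch P n \<Longrightarrow> Q c) \<Longrightarrow> Q n"
  shows "Q n"
  using wf_edges_converse assms(1)
proof (induction n)
  case (less n)
  show ?case
  proof (rule assms(2)[OF less.prems])
    fix c assume "c \<in> ch P n"
    then show "Q c"
      using less.IH[of c] less.prems by (auto simp: edges_iff intro: ch_in_nodes)
  qed
qed

text \<open>The root reaches every node, so an edge back to it would close a cycle.\<close>

lemma root_not_child: "n \<in> nodes P \<Longrightarrow> root_at P \<notin> ch P n"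
proof
  assume n: "n \<in> nodes P" "root_at P \<in> ch P n"
  have "n \<in> nodes P \<Longrightarrow> (root_at P, n) \<in> (edges P)\<^sup>*" for n
    by (induction rule: nodes_induct) (auto simp: edges_iff intro: rtrancl_into_rtrancl)
  then have "(root_at P, root_at P) \<in> (edges P)\<^sup>+"
    using n by (meson edges_iff rtrancl_into_trancl1)
  then show False
    using acyclic_edges by (simp add: acyclic_def)
qed

lemma children_distinct: "n \<in> nodes P \<Longrightarrow> distinct (children_of (node_at P n))"
  using valid_node[of n] by (cases "node_at P n") auto

lemma length_children: "n \<in> nodes P \<Longrightarrow> length (children_of (node_at P n)) = card (ch P n)"
  by (simp add: ch_def children_distinct distinct_card)

lemma pc_size_eq: "pc_size P = (\<Sum>n\<in>nodes P. card (ch P n))"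
  unfolding pc_size_def edges_eq_Sigma by (simp add: finite_nodes finite_ch)

text \<open>Every node except the root is the lower end of some edge.\<close>

lemma card_nodes: "card (nodes P) \<le> pc_size P + 1"
proof -
  have "nodes P \<subseteq> insert (root_at P) (snd ` edges P)"
  proof
    fix n assume "n \<in> nodes P"
    then consider "n = root_at P" | m where "m \<in> nodes P" "n \<in> ch P m"
      using nodes_eq by blast
    then show "n \<in> insert (root_at P) (snd ` edges P)"
      using edges_iff by cases (simp, metis image_eqI insertCI snd_conv)
  qed
  then have "card (nodes P) \<le> card (insert (root_at P) (snd ` edges P))"
    by (simp add: card_mono finite_edges)
  also have "\<dots> \<le> Suc (card (snd ` edges P))"
    by (rule card_insert_le_m1) (simp_all)
  also have "\<dots> \<le> pc_size P + 1"
    by (simp add: pc_size_def card_image_le finite_edges)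
  finally show ?thesis .
qed

section \<open>Scopes and the parameters \<open>d\<close> and \<open>C\<close>\<close>

lemma scope_child:
  assumes "n \<in> nodes P" "c \<in> ch P n"
  shows "scope P c \<subseteq> scope P n"
  using assms by (auto simp: scope_unfold[of n] ch_def split: node.split)

lemma scope_subset: "n \<in> nodes P \<Longrightarrow> scope P n \<subseteq> {..<d}"
  by (induction rule: nodes_induct) (use scope_root scope_child in blast)+

lemma finite_scope: "n \<in> nodes P \<Longrightarrow> finite (scope P n)"
  using scope_subset finite_subset by blast

lemma input_var_less: "n \<in> nodes P \<Longrightarrow> node_at P n = Input i f \<Longrightarrow> i < d"
  using scope_subset[of n] by (simp add: scope_unfold)

text \<open>For a sum node the reason is that its parameters add up to 1, which an empty sum
  cannot.\<close>

lemma ch_nonempty: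
  assumes "n \<in> nodes P" "\<not> (\<exists>i f. node_at P n = Input i f)"
  shows "ch P n \<noteq> {}"
  using valid_node[OF assms(1)] assms(2) by (cases "node_at P n") (auto simp: ch_def)

lemma scope_nonempty: "n \<in> nodes P \<Longrightarrow> scope P n \<noteq> {}"
proof (induction rule: node_induct)
  case (node n)
  then show ?case
    using ch_nonempty[of n] by (auto simp: scope_unfold split: node.split)
qed

lemma d_pos: "0 < d"
  using scope_nonempty[OF root_in_nodes] scope_root by auto

lemma input_node_exists:
  assumes "i < d"
  obtains n f where "n \<in> nodes P" "node_at P n = Input i f"
proof -
  obtain m f where m: "(root_at P, m) \<in> (edges P)\<^sup>*" "node_at P m = Input i f"
    using assms scope_root unfolding scope_def by blast
  have "m \<in> nodes P"
    using m(1) edges_subset root_in_nodes by (induction rule: rtrancl_induct) auto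
  then show thesis
    using m that by blast
qed

text \<open>The scope of the root is non-empty, so some input node exists, and its distribution
  could not sum to 1 without categories.\<close>

lemma C_pos: "0 < C"
proof -
  obtain n f where "n \<in> nodes P" "node_at P n = Input 0 f"
    using input_node_exists d_pos by metis
  then show ?thesis
    using valid_node[of n] by (cases "C = 0") auto
qed

text \<open>Each variable has an input node, and an input node carries only one variable.\<close>

lemma d_le_card_nodes: "d \<le> card (nodes P)"
proof -
  \<comment> \<open>The value 0 at inner nodes is arbitrary: the map only has to reach every
    variable.\<close>
  have "{..<d} \<subseteq> (\<lambda>n. case node_at P n of Input i f \<Rightarrow> i | _ \<Rightarrow> 0) ` nodes P"
  proof
    fix i assume "i \<in> {..<d}"
    then obtain n f where "n \<in> nodes P" "node_at P n = Input i f"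
      using input_node_exists by auto
    then show "i \<in> (\<lambda>n. case node_at P n of Input i f \<Rightarrow> i | _ \<Rightarrow> 0) ` nodes P"
      by (force intro: image_eqI[of _ _ n])
  qed
  then show ?thesis
    using surj_card_le[OF finite_nodes] by fastforce
qed

text \<open>With at least one edge, \<open>d\<close> is at most the number of nodes, hence at most
  \<open>pc_size P + 1 \<le> 2 * pc_size P\<close>.\<close>

lemma size_bound: "0 < pc_size P \<Longrightarrow> pc_size P + d * C \<le> (1 + 2 * C) * pc_size P"
proof -
  assume "0 < pc_size P"
  then have "d \<le> 2 * pc_size P"
    using d_le_card_nodes card_nodes by linarith
  then have "d * C \<le> 2 * pc_size P * C"
    by (rule mult_right_mono) simp
  then show ?thesis
    by (simp add: algebra_simps)
qed

lemmas node_value_eq = node_value_unfold[OF is_pc]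

text \<open>Evaluation at \<open>n\<close> only reads input nodes below \<open>n\<close>. This
  serves to restrict assignments to a scope and to change the weights of a variable outside
  it.\<close>

lemma node_value_cong:
  assumes "n \<in> nodes P" "\<And>i f. i \<in> scope P n \<Longrightarrow> leaf i f = leaf' i f"
  shows "node_value leaf P n = node_value leaf' P n"
  using assms
proof (induction rule: node_induct)
  case (node n)
  have "node_value leaf P c = node_value leaf' P c" if "c \<in> ch P n" for c
    using node that scope_child by blast
  then show ?case
    using node by (auto simp: node_value_eq scope_unfold split: node.split intro!: prod.cong sum.cong)
qed

end

section \<open>Depth-first search\<close>

text \<open>Parents precede children, and the list is closed under children. Recursion from the left
  fits a search that prepends finished nodes.\<close>

fun topological :: "pc \<Rightarrow> nat list \<Rightarrow> bool" where
  "topological P [] \<longleftrightarrow> True"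
| "topological P (n # ns) \<longleftrightarrow> n \<notin> set ns \<and> ch P n \<subseteq> set ns \<and> topological P ns"

lemma topological_distinct: "topological P ns \<Longrightarrow> distinct ns"
  by (induction ns) auto

lemma topological_append: "topological P (xs @ ys) \<Longrightarrow> topological P ys"
  by (induction xs) auto

lemma topological_ch: "topological P ns \<Longrightarrow> n \<in> set ns \<Longrightarrow> ch P n \<subseteq> set ns"
  by (induction ns) auto

type_synonym dfs_state = "(nat \<times> nat list) list \<times> (nat \<Rightarrow> bool) \<times> nat list"

text \<open>The loop body of \<open>preorder\<close> gets a name so that invariant and potential can
  be checked for one iteration at a time.\<close>

definition dfs_step :: "pc \<Rightarrow> dfs_state \<Rightarrow> dfs_state tm" where
  "dfs_step P = (\<lambda>(stack, vis, ord). case stack of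
      [] \<Rightarrow> ret (stack, vis, ord)
    | (n, []) # stack' \<Rightarrow> do {
        ord' \<leftarrow> op (n # ord);
        ret (stack', vis, ord')
      }
    | (n, c # cs) # stack' \<Rightarrow> do {
        seen \<leftarrow> op (vis c);
        if seen then op ((n, cs) # stack', vis, ord)
        else do {
          vis' \<leftarrow> op (vis(c := True));
          ds \<leftarrow> op (children_of (node_at P c));
          stack'' \<leftarrow> op ((n, cs) # stack');
          op ((c, ds) # stack'', vis', ord)
        }
      })"

definition dfs_loop :: "pc \<Rightarrow> dfs_state tm" where
  "dfs_loop P = while_loop (\<lambda>(stack, vis, ord). stack \<noteq> []) (dfs_step P)
     ([(root_at P, children_of (node_at P (root_at P)))], (\<lambda>_. False)(root_at P := True), [])"

lemma val_preorder: "val (preorder P) = snd (snd (val (dfs_loop P)))"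
  and time_preorder: "time (preorder P) = 4 + time (dfs_loop P)"
  unfolding preorder_def dfs_loop_def dfs_step_def by (auto split: prod.split)

lemma Collect_upd_True: "Collect (vis(c := True)) = insert c (Collect vis)"
  by auto

context circuit
begin

text \<open>A stack frame holds a node and the children still to be tried; those already removed
  from the frame must be marked.\<close>

definition explored :: "(nat \<Rightarrow> bool) \<Rightarrow> nat \<times> nat list \<Rightarrow> bool" where
  "explored vis = (\<lambda>(n, cs). set cs \<subseteq> ch P n \<and> (\<forall>c\<in>ch P n - set cs. vis c))"

text \<open>The \<open>sorted_wrt\<close> conjunct makes the stack a chain in which each entry is
  reachable from all entries below it; with acyclicity this excludes edges back into the stack. The
  mark on the root ensures that it ends up in the finished list.\<close>

fun dfs_inv :: "dfs_state \<Rightarrow> bool" where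
  "dfs_inv (stack, vis, ord) \<longleftrightarrow>
     (\<forall>n. vis n \<longleftrightarrow> n \<in> fst ` set stack \<union> set ord) \<and>
     fst ` set stack \<inter> set ord = {} \<and>
     vis (root_at P) \<and> fst ` set stack \<union> set ord \<subseteq> nodes P \<and>
     sorted_wrt (\<lambda>a b. (b, a) \<in> (edges P)\<^sup>+) (map fst stack) \<and>
     (\<forall>x\<in>set stack. explored vis x) \<and>
     topological P ord"

text \<open>Every frame still owes one pop and one look at each remaining child, and every unmarked
  node will owe the same. Each unit is worth 6, the cost of the most expensive iteration: five
  operations for a push and one loop test.\<close>

fun dfs_pot :: "dfs_state \<Rightarrow> nat" where
  "dfs_pot (stack, vis, ord) =
     6 * ((\<Sum>(n, cs)\<leftarrow>stack. length cs + 1) + (\<Sum>n\<in>nodes P - Collect vis. card (ch P n) + 1))"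

lemma explored_upd: "explored vis x \<Longrightarrow> explored (vis(c := True)) x"
  by (auto simp: explored_def)

text \<open>All children of \<open>n\<close> are marked, so each is on the stack or finished. One on
  the stack would close a cycle, so all are finished and \<open>n\<close> may go in front of
  them.\<close>

lemma dfs_step_pop:
  assumes "dfs_inv ((n, []) # stack, vis, ord)"
  shows "dfs_inv (stack, vis, n # ord)"
proof -
  have on_stack: "(a, n) \<in> (edges P)\<^sup>+" if "a \<in> fst ` set stack" for a
    using assms that by auto
  have n: "n \<in> nodes P" "explored vis (n, [])"
    using assms by auto
  have "c \<notin> insert n (fst ` set stack)" if "c \<in> ch P n" for c
    using that on_stack acyclic_edges n unfolding acyclic_def
    by (metis edges_iff insertE trancl.r_into_trancl trancl.trancl_into_trancl)
  moreover have "vis c" if "c \<in> ch P n" for c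
    using n that by (simp add: explored_def)
  ultimately have "ch P n \<subseteq> set ord"
    using assms by auto
  moreover have "n \<notin> fst ` set stack"
    using on_stack acyclic_edges unfolding acyclic_def by blast
  ultimately show ?thesis
    using assms by auto
qed

lemma dfs_step_seen:
  assumes "dfs_inv ((n, c # cs) # stack, vis, ord)" "vis c"
  shows "dfs_inv ((n, cs) # stack, vis, ord)"
proof -
  have "explored vis (n, cs)"
    using assms by (auto simp: explored_def)
  then show ?thesis
    using assms by auto
qed

lemma dfs_step_push:
  assumes "dfs_inv ((n, c # cs) # stack, vis, ord)" "\<not> vis c"
  shows "dfs_inv ((c, children_of (node_at P c)) # (n, cs) # stack, vis(c := True), ord)"
proof -
  have n: "n \<in> nodes P" "c \<in> ch P n"
    using assms by (auto simp: explored_def)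
  have "(n, c) \<in> edges P"
    using n by (simp add: edges_iff)
  moreover have "(a, n) \<in> (edges P)\<^sup>+" if "a \<in> fst ` set stack" for a
    using assms(1) that by auto
  ultimately have "(n, c) \<in> (edges P)\<^sup>+" "\<forall>a\<in>fst ` set stack. (a, c) \<in> (edges P)\<^sup>+"
    by (blast intro: trancl_into_trancl)+
  moreover have "c \<in> nodes P"
    using n ch_in_nodes by blast
  moreover have "explored (vis(c := True)) (n, cs)"
    using assms by (auto simp: explored_def)
  moreover have "explored (vis(c := True)) (c, children_of (node_at P c))"
    by (simp add: explored_def ch_def)
  moreover have "\<forall>x\<in>set stack. explored (vis(c := True)) x"
    using assms(1) explored_upd by simp
  moreover have "c \<notin> set ord" "c \<notin> fst ` set stack" "c \<noteq> n"
    using assms by auto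
  ultimately show ?thesis
    using assms(1) by auto
qed

text \<open>Marking \<open>c\<close> moves its contribution from the unmarked nodes to the new
  frame, so only the consumed child entry, worth 6, is lost.\<close>

lemma dfs_pot_push:
  assumes "\<not> vis c" "c \<in> nodes P"
  shows "dfs_pot ((c, children_of (node_at P c)) # (n, cs) # stack, vis(c := True), ord) + 6 =
    dfs_pot ((n, c # cs) # stack, vis, ord)"
proof -
  have "nodes P - Collect (vis(c := True)) = nodes P - Collect vis - {c}"
    by (auto simp: Collect_upd_True)
  moreover have "(\<Sum>n\<in>nodes P - Collect vis. card (ch P n) + 1) =
      (card (ch P c) + 1) + (\<Sum>n\<in>nodes P - Collect vis - {c}. card (ch P n) + 1)"
    by (rule sum.remove) (use assms finite_nodes in simp_all)
  ultimately show ?thesis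
    using assms by (simp add: length_children del: add_Suc_right)
qed

lemma dfs_step:
  assumes "dfs_inv s" "case s of (stack, vis, ord) \<Rightarrow> stack \<noteq> []"
  shows "dfs_inv (val (dfs_step P s)) \<and>
    time (dfs_step P s) + 1 + dfs_pot (val (dfs_step P s)) \<le> dfs_pot s"
proof -
  obtain n cs stack vis ord where s: "s = ((n, cs) # stack, vis, ord)"
    using assms(2) by (cases s) (auto simp: neq_Nil_conv)
  show ?thesis
  proof (cases cs)
    case Nil
    then show ?thesis
      using assms(1) dfs_step_pop[of n stack vis ord]
      by (simp add: s Nil dfs_step_def del: dfs_inv.simps)
  next
    case (Cons c cs')
    show ?thesis
    proof (cases "vis c")
      case True
      then show ?thesis
        using assms(1) dfs_step_seen[of n c cs' stack vis ord]
        by (simp add: s Cons dfs_step_def del: dfs_inv.simps)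
    next
      case False
      have "n \<in> nodes P" "c \<in> ch P n"
        using assms(1) by (auto simp: s Cons explored_def)
      then have "c \<in> nodes P"
        using ch_in_nodes by blast
      then show ?thesis
        using dfs_step_push[of n c cs' stack vis ord] dfs_pot_push[of vis c n cs' stack ord]
          assms(1) False
        by (simp add: s Cons dfs_step_def del: dfs_inv.simps dfs_pot.simps)
    qed
  qed
qed

lemma preorder_correct:
  shows set_preorder: "set (val (preorder P)) = nodes P"
    and topological_preorder: "topological P (val (preorder P))"
    and time_preorder_le: "time (preorder P) \<le> 5 + 6 * (card (nodes P) + pc_size P)"
proof -
  let ?r = "root_at P"
  define s\<^sub>0 :: dfs_state
    where "s\<^sub>0 = ([(?r, children_of (node_at P ?r))], (\<lambda>_. False)(?r := True), [])"
  obtain stack vis ord where res: "val (dfs_loop P) = (stack, vis, ord)"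
    by (metis prod_cases3)
  have "dfs_inv s\<^sub>0"
    by (simp add: s\<^sub>0_def root_in_nodes ch_def explored_def)
  then have "dfs_inv (val (dfs_loop P)) \<and>
      \<not> (case val (dfs_loop P) of (stack, vis, ord) \<Rightarrow> stack \<noteq> []) \<and>
      time (dfs_loop P) \<le> dfs_pot s\<^sub>0 + 1"
    unfolding dfs_loop_def s\<^sub>0_def[symmetric] by (rule while_loop_rule) (rule dfs_step)
  then have *: "dfs_inv (stack, vis, ord)" "stack = []" "time (dfs_loop P) \<le> dfs_pot s\<^sub>0 + 1"
    unfolding res by (auto simp del: dfs_inv.simps dfs_pot.simps)
  \<comment> \<open>With an empty stack the marked root lies in \<open>ord\<close>, and
    \<open>ord\<close> is closed under children.\<close>
  have "n \<in> set ord" if "n \<in> nodes P" for n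
    using that *(1,2) topological_ch[of P ord] by (induction rule: nodes_induct) auto
  then show "set (val (preorder P)) = nodes P"
    using * res by (auto simp: val_preorder)
  show "topological P (val (preorder P))"
    using * res by (simp add: val_preorder)
  \<comment> \<open>The root starts out marked with its frame on the stack, so the initial potential
    counts every node exactly once.\<close>
  have "nodes P - Collect ((\<lambda>_. False)(?r := True)) = nodes P - {?r}"
    by (simp add: Collect_upd_True)
  moreover have "(\<Sum>n\<in>nodes P. card (ch P n) + 1) =
      (card (ch P ?r) + 1) + (\<Sum>n\<in>nodes P - {?r}. card (ch P n) + 1)"
    by (rule sum.remove) (simp_all add: finite_nodes root_in_nodes)
  ultimately have "dfs_pot s\<^sub>0 = 6 * (\<Sum>n\<in>nodes P. card (ch P n) + 1)"
    by (simp add: s\<^sub>0_def length_children root_in_nodes)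
  also have "\<dots> = 6 * (card (nodes P) + pc_size P)"
    by (simp add: pc_size_eq sum.distrib del: add_Suc_right)
  finally show "time (preorder P) \<le> 5 + 6 * (card (nodes P) + pc_size P)"
    using *(3) by (simp add: time_preorder)
qed

lemmas distinct_preorder = topological_distinct[OF topological_preorder]

lemma length_preorder: "length (val (preorder P)) = card (nodes P)"
  using distinct_card[OF distinct_preorder] set_preorder by simp

lemma sum_list_preorder: "(\<Sum>n\<leftarrow>val (preorder P). g n) = (\<Sum>n\<in>nodes P. g n :: nat)"
  using sum_list_distinct_conv_sum_set[OF distinct_preorder] set_preorder by simp

end

section \<open>The passes of the algorithm\<close>

lemma case_val: "val (case k of Input i f \<Rightarrow> a i f | Product cs \<Rightarrow> b cs | Sum cs \<theta> \<Rightarrow> c cs \<theta>) =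
    (case k of Input i f \<Rightarrow> val (a i f) | Product cs \<Rightarrow> val (b cs) | Sum cs \<theta> \<Rightarrow> val (c cs \<theta>))"
  by (cases k) simp_all

lemma fold_cons_upd:
  assumes "distinct cs"
  shows "fold (\<lambda>c f. f(c := m # f c)) cs f = (\<lambda>c. if c \<in> set cs then m # f c else f c)"
  using assms by (induction cs arbitrary: f) auto

lemma fold_upd2:
  "fold (\<lambda>v R. R(i := (R i)(v := g v))) vs R j v = (if j = i \<and> v \<in> set vs then g v else R j v)"
  by (induction vs arbitrary: R) auto

lemma fold_fold_upd2:
  "fold (\<lambda>i R. fold (\<lambda>v R. R(i := (R i)(v := g i v))) vs R) is R j v =
    (if j \<in> set is \<and> v \<in> set vs then g j v else R j v)"
  by (induction "is" arbitrary: R) (auto simp: fold_upd2)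

context circuit
begin

definition parents :: "nat \<Rightarrow> nat set" where
  "parents n = {m \<in> nodes P. n \<in> ch P m}"

definition inputs :: "nat \<Rightarrow> nat set" where
  "inputs i = {n \<in> nodes P. \<exists>f. node_at P n = Input i f}"

lemma finite_parents: "finite (parents n)"
  by (simp add: parents_def finite_nodes)

text \<open>Each edge is counted once, at its lower end.\<close>

lemma sum_card_parents: "(\<Sum>n\<in>nodes P. card (parents n)) = pc_size P"
proof -
  have "bij_betw prod.swap (SIGMA n:nodes P. parents n) (edges P)"
    by (rule bij_betwI[where g = prod.swap]) (auto simp: parents_def edges_iff ch_in_nodes)
  then show ?thesis
    by (simp add: pc_size_def bij_betw_same_card[symmetric] finite_nodes finite_parents)
qed

text \<open>The sets for different variables are disjoint, so visiting all of them costs no more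
  than visiting every node once.\<close>

lemma sum_card_inputs: "(\<Sum>i<d. card (inputs i)) \<le> card (nodes P)"
proof -
  have "(\<Sum>i<d. card (inputs i)) = card (\<Union>i<d. inputs i)"
    by (rule card_UN_disjoint[symmetric]) (auto simp: inputs_def finite_nodes)
  also have "\<dots> \<le> card (nodes P)"
    by (rule card_mono) (auto simp: finite_nodes inputs_def)
  finally show ?thesis .
qed

section \<open>Results of the single passes\<close>

lemma val_forward_node:
  assumes "n \<in> nodes P" "\<And>c. c \<in> ch P n \<Longrightarrow> fw c = fw_value C w P c"
  shows "val (forward_node C w P fw n) = fw_value C w P n"
  using assms children_distinct[OF assms(1)]
  by (cases "node_at P n")
    (auto simp: forward_node_def fw_value_def node_value_eq ch_def fold_plus_eq_sum
      fold_times_eq_prod lessThan_atLeast0)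

text \<open>Reversing \<open>m # ord\<close> puts \<open>m\<close> last, when its children, which
  lie in \<open>ord\<close>, already have their final values.\<close>

lemma val_forward_pass:
  assumes "topological P ord" "set ord \<subseteq> nodes P" "n \<in> set ord"
  shows "val (forward_pass C w P (rev ord)) n = fw_value C w P n"
  using assms
proof (induction ord arbitrary: n)
  case (Cons m ord)
  define fw where "fw = val (forward_pass C w P (rev ord))"
  have "val (forward_pass C w P (rev (m # ord))) = fw(m := val (forward_node C w P fw m))"
    by (simp add: fw_def forward_pass_def)
  moreover have "fw c = fw_value C w P c" if "c \<in> set ord" for c
    using Cons that by (simp add: fw_def)
  ultimately show ?case
    using Cons.prems val_forward_node[of m fw w] by auto
qed simp

lemma val_parent_lists_aux:
  assumes "set ord \<subseteq> nodes P"
  shows "fold (\<lambda>m. fold (\<lambda>c par. par(c := m # par c)) (children_of (node_at P m))) ord par n =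
    rev (filter (\<lambda>m. n \<in> ch P m) ord) @ par n"
  using assms
  by (induction ord arbitrary: par) (auto simp: fold_cons_upd children_distinct ch_def)

lemma val_parent_lists:
  assumes "set ord \<subseteq> nodes P"
  shows "val (parent_lists P ord) n = rev (filter (\<lambda>m. n \<in> ch P m) ord)"
  using val_parent_lists_aux[OF assms, of "\<lambda>_. []"] by (simp add: parent_lists_def)

lemma val_gather_inputs_aux:
  "fold (\<lambda>n S. case node_at P n of Input i f \<Rightarrow> S(i := n # S i) | _ \<Rightarrow> S) ord S i =
    rev (filter (\<lambda>n. \<exists>f. node_at P n = Input i f) ord) @ S i"
  by (induction ord arbitrary: S) (auto split: node.split)

lemma val_gather_inputs:
  "val (gather_inputs P ord) i = rev (filter (\<lambda>n. \<exists>f. node_at P n = Input i f) ord)"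
  using val_gather_inputs_aux[of ord "\<lambda>_. []"] by (simp add: gather_inputs_def case_val cong: node.case_cong)

lemma val_backward_node:
  assumes "distinct (par n)" "set (par n) = parents n"
  shows "val (backward_node P fw par bk n) =
    (case node_at P n of
       Product cs \<Rightarrow> (\<Sum>m\<in>parents n. param (node_at P m) n * fw n / fw m * bk m)
     | _ \<Rightarrow> (\<Sum>m\<in>parents n. bk m))"
  using assms by (cases "node_at P n") (auto simp: backward_node_def fold_plus_eq_sum)

text \<open>Although the pass is sequential, its final array satisfies the recursive equation:
  parents precede \<open>n\<close> in \<open>ord\<close>, so their entries are final when
  \<open>n\<close> is processed.\<close>

lemma val_backward_pass:
  assumes ord: "topological P ord" "set ord = nodes P" and n: "n \<in> nodes P"
    and par: "\<And>n. n \<in> nodes P \<Longrightarrow> distinct (par n) \<and> set (par n) = parents n"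
    and bk: "bk = val (backward_pass P fw par ord)"
  shows "bk n = (if n = root_at P then 1 else val (backward_node P fw par bk n))"
proof -
  define g where "g n bk = (if n = root_at P then 1 else val (backward_node P fw par bk n))" for n bk
  have bk_fold: "bk = fold (\<lambda>n bk. bk(n := g n bk)) ord (\<lambda>_. 0)"
    by (auto simp: bk backward_pass_def g_def intro!: fold_cong)
  obtain xs ys where ord_eq: "ord = xs @ n # ys"
    using n ord by (metis split_list)
  define bk' where "bk' = fold (\<lambda>n bk. bk(n := g n bk)) xs (\<lambda>_. 0)"
  have bk_eq: "bk = fold (\<lambda>n bk. bk(n := g n bk)) ys (bk'(n := g n bk'))"
    by (simp add: bk_fold ord_eq bk'_def)
  have top: "topological P (n # ys)"
    using ord ord_eq topological_append by metis
  \<comment> \<open>Parents of \<open>n\<close> lie in \<open>xs\<close>, so nothing written from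
    \<open>n\<close> onwards touches their entries.\<close>
  have "bk m = bk' m" if "m \<in> parents n" for m
  proof -
    have "m \<notin> set (n # ys)"
      using that top topological_ch[of P ys m] by (auto simp: parents_def)
    then show ?thesis
      by (simp add: bk_eq fold_upd_notin)
  qed
  moreover have "bk n = g n bk'"
    using top by (simp add: bk_eq fold_upd_notin)
  ultimately show ?thesis
    using par[OF n] by (auto simp: g_def val_backward_node split: node.split intro!: sum.cong)
qed

lemma val_read_out:
  assumes "i < d" "v < C" "distinct (S i)"
  shows "val (read_out d C w P fw bk S) i v =
    (\<Sum>n\<in>set (S i). bk n * input_dist (node_at P n) v * w i v / fw n)"
  using assms by (simp add: read_out_def fold_fold_upd2 fold_plus_eq_sum)

section \<open>Intermediate tables of one run\<close>

definition fw_table :: "(nat \<Rightarrow> nat \<Rightarrow> real) \<Rightarrow> nat \<Rightarrow> real" where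
  "fw_table w = val (forward_pass C w P (rev (val (preorder P))))"

definition parent_table :: "nat \<Rightarrow> nat list" where
  "parent_table = val (parent_lists P (val (preorder P)))"

definition bk_table :: "(nat \<Rightarrow> nat \<Rightarrow> real) \<Rightarrow> nat \<Rightarrow> real" where
  "bk_table w = val (backward_pass P (fw_table w) parent_table (val (preorder P)))"

definition input_table :: "nat \<Rightarrow> nat list" where
  "input_table = val (gather_inputs P (val (preorder P)))"

lemma parent_table: "distinct (parent_table n)" "set (parent_table n) = parents n"
  using set_preorder distinct_preorder by (auto simp: parent_table_def val_parent_lists parents_def)

lemma input_table: "distinct (input_table i)" "set (input_table i) = inputs i"
  using set_preorder distinct_preorder by (auto simp: input_table_def val_gather_inputs inputs_def)

lemma fw_table: "n \<in> nodes P \<Longrightarrow> fw_table w n = fw_value C w P n"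
  using val_forward_pass[OF topological_preorder] by (simp add: fw_table_def set_preorder)

lemma bk_table_unfold:
  assumes "n \<in> nodes P"
  shows "bk_table w n = (if n = root_at P then 1 else
    (case node_at P n of
       Product cs \<Rightarrow>
         (\<Sum>m\<in>parents n. param (node_at P m) n * fw_table w n / fw_table w m * bk_table w m)
     | _ \<Rightarrow> (\<Sum>m\<in>parents n. bk_table w m)))"
  using val_backward_pass[OF topological_preorder set_preorder assms _ bk_table_def]
  by (simp add: parent_table val_backward_node)

lemma fold_rev_preorder: "fold (#) (val (preorder P)) [] = rev (val (preorder P))"
  by (simp add: fold_Cons_rev)

lemma val_forward_backward:
  assumes "i < d" "v < C"
  shows "val (forward_backward d C w P) i v =
    (\<Sum>n\<in>inputs i. bk_table w n * input_dist (node_at P n) v * w i v / fw_table w n)"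
  using assms
  by (simp add: forward_backward_def rev_tm_def fold_rev_preorder input_table val_read_out
      flip: fw_table_def parent_table_def bk_table_def input_table_def)

section \<open>Running time\<close>

lemma time_forward_pass:
  assumes "distinct post" "set post = nodes P"
  shows "time (forward_pass C w P post) \<le> 2 + 4 * card (nodes P) + 5 * (C * card (nodes P)) + 5 * pc_size P"
proof -
  \<comment> \<open>One bound for all kinds of node: an input node pays for its categories, an inner
    node for its children, with at most 4 operations and one loop unit each.\<close>
  have "time (forward_node C w P fw n) \<le> 2 + 5 * C + 5 * card (ch P n)" if "n \<in> nodes P" for n fw
  proof (cases "node_at P n")
    case (Input i f)
    have "time (forward_node C w P fw n) \<le> 1 + (1 + (4 + 1) * length [0..<C])"
      unfolding forward_node_def Input by simp (rule order.trans[OF time_for_each_const[of _ _ 4]], auto)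
    then show ?thesis by simp
  next
    case (Product cs)
    have "time (forward_node C w P fw n) \<le> 1 + (1 + (4 + 1) * length cs)"
      unfolding forward_node_def Product by simp (rule order.trans[OF time_for_each_const[of _ _ 4]], auto)
    then show ?thesis
      using length_children[OF that] by (simp add: Product)
  next
    case (Sum cs \<theta>)
    have "time (forward_node C w P fw n) \<le> 1 + (1 + (4 + 1) * length cs)"
      unfolding forward_node_def Sum by simp (rule order.trans[OF time_for_each_const[of _ _ 4]], auto)
    then show ?thesis
      using length_children[OF that] by (simp add: Sum)
  qed
  then have "time (forward_pass C w P post) \<le>
      1 + (1 + (\<Sum>n\<leftarrow>post. (2 + 5 * C + 5 * card (ch P n) + 1) + 1))"
    unfolding forward_pass_def time_bind time_op val_op
    by (intro add_left_mono time_for_each) (simp add: assms)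
  also have "\<dots> = 2 + (\<Sum>n\<in>nodes P. (4 + 5 * C) + 5 * card (ch P n))"
    using assms by (auto simp: sum_list_distinct_conv_sum_set intro!: sum.cong)
  also have "\<dots> = 2 + 4 * card (nodes P) + 5 * (C * card (nodes P)) + 5 * pc_size P"
    by (simp only: sum.distrib pc_size_eq sum_distrib_left sum_constant)
      (simp add: algebra_simps)
  finally show ?thesis .
qed

lemma time_parent_lists:
  assumes "distinct ord" "set ord = nodes P"
  shows "time (parent_lists P ord) \<le> 2 + 3 * card (nodes P) + 4 * pc_size P"
proof -
  have "time (parent_lists P ord) \<le>
      1 + (1 + (\<Sum>m\<leftarrow>ord. (1 + (1 + (3 + 1) * length (children_of (node_at P m)))) + 1))"
    unfolding parent_lists_def time_bind time_op val_op
    by (intro add_left_mono time_for_each, unfold time_bind time_op val_op)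
      (intro add_left_mono time_for_each_const, simp)
  also have "\<dots> = 2 + (\<Sum>m\<in>nodes P. 3 + 4 * card (ch P m))"
    using assms by (auto simp: sum_list_distinct_conv_sum_set length_children intro!: sum.cong)
  also have "\<dots> = 2 + 3 * card (nodes P) + 4 * pc_size P"
    by (simp only: sum.distrib pc_size_eq sum_distrib_left sum_constant) simp
  finally show ?thesis .
qed

text \<open>The work at a node is linear in the number of its parents, and these numbers add up to
  the number of edges.\<close>

lemma time_backward_pass:
  assumes "distinct ord" "set ord = nodes P"
    and par: "\<And>n. n \<in> nodes P \<Longrightarrow> length (par n) = card (parents n)"
  shows "time (backward_pass P fw par ord) \<le> 2 + 6 * card (nodes P) + 10 * pc_size P"
proof -
  have "time (backward_node P fw par bk n) \<le> 2 + (1 + (9 + 1) * length (par n))" for bk n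
    unfolding backward_node_def time_bind time_op val_op
    by (cases "node_at P n") (auto intro!: order.trans[OF time_for_each_const[of _ _ 9]])
  then have "time (backward_pass P fw par ord) \<le>
      1 + (1 + (\<Sum>n\<leftarrow>ord. (1 + (2 + (1 + 10 * length (par n))) + 1) + 1))"
    unfolding backward_pass_def time_bind time_op val_op
    by (intro add_left_mono time_for_each) (auto simp: assms(2))
  also have "\<dots> = 2 + (\<Sum>n\<in>nodes P. 6 + 10 * card (parents n))"
    using assms by (auto simp: sum_list_distinct_conv_sum_set intro!: sum.cong)
  also have "\<dots> = 2 + 6 * card (nodes P) + 10 * pc_size P"
    by (simp only: sum.distrib sum_card_parents[symmetric] sum_distrib_left sum_constant) simp
  finally show ?thesis .
qed

lemma time_gather_inputs: "time (gather_inputs P ord) \<le> 2 + 5 * length ord"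
proof -
  have "time (gather_inputs P ord) \<le> 1 + (1 + (4 + 1) * length ord)"
    unfolding gather_inputs_def time_bind time_op val_op
    by (intro add_left_mono time_for_each_const) (simp split: node.split)
  then show ?thesis by simp
qed

text \<open>For each of the \<open>C\<close> categories the lists of all variables are traversed
  once; together they are no longer than the number of nodes.\<close>

lemma time_read_out:
  assumes "\<And>i. length (S i) = card (inputs i)"
  shows "time (read_out d C w P fw bk S) \<le> 2 + 2 * d + 4 * (d * C) + 10 * (C * card (nodes P))"
proof -
  have "time (read_out d C w P fw bk S) \<le>
      1 + (1 + (\<Sum>i\<leftarrow>[0..<d]. (1 + ((1 + ((1 + (9 + 1) * length (S i)) + 1)) + 1) * length [0..<C]) + 1))"
    unfolding read_out_def time_bind time_op val_op
    by (intro add_left_mono time_for_each time_for_each_const, unfold time_bind time_op val_op)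
      (intro add_left_mono add_right_mono time_for_each_const, simp)
  also have "\<dots> = 2 + (\<Sum>i<d. (2 + 4 * C) + 10 * C * card (inputs i))"
    by (simp add: assms sum_list_distinct_conv_sum_set lessThan_atLeast0 algebra_simps)
  also have "\<dots> = 2 + 2 * d + 4 * (d * C) + 10 * (C * (\<Sum>i<d. card (inputs i)))"
    by (simp only: sum.distrib sum_distrib_left[symmetric] sum_constant) (simp add: algebra_simps)
  also have "\<dots> \<le> 2 + 2 * d + 4 * (d * C) + 10 * (C * card (nodes P))"
    by (intro add_left_mono mult_left_mono sum_card_inputs) simp_all
  finally show ?thesis .
qed

text \<open>The term \<open>d * C \<ge> 1\<close> absorbs the additive 1 of
  \<open>card_nodes\<close>, which matters for a single input node without edges.\<close>

lemma card_nodes_le: "card (nodes P) \<le> pc_size P + d * C"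
proof -
  have "1 \<le> d * C"
    using C_pos d_pos by (simp add: Suc_leI)
  then show ?thesis
    using card_nodes by linarith
qed

lemma time_forward_backward:
  "time (forward_backward d C w P) \<le> (80 + 15 * C) * (pc_size P + d * C)"
proof -
  let ?ord = "val (preorder P)"
  have ord: "set ?ord = nodes P" "distinct ?ord" "length ?ord = card (nodes P)"
    using set_preorder distinct_preorder length_preorder by simp_all
  let ?N = "card (nodes P)" and ?s = "pc_size P + d * C"
  have "time (forward_backward d C w P) =
      time (preorder P) + (time (rev_tm ?ord) + (time (forward_pass C w P (rev ?ord)) +
      (time (parent_lists P ?ord) + (time (backward_pass P (fw_table w) parent_table ?ord) +
      (time (gather_inputs P ?ord) + time (read_out d C w P (fw_table w) (bk_table w) input_table))))))"
    by (simp add: forward_backward_def rev_tm_def fold_rev_preorder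
        flip: fw_table_def parent_table_def bk_table_def input_table_def)
  moreover have "time (preorder P) \<le> 5 + 6 * (?N + pc_size P)"
    by (rule time_preorder_le)
  moreover have "time (rev_tm ?ord) \<le> 1 + 2 * ?N"
    using time_for_each_const[of ?ord "\<lambda>x ys. op (x # ys)" 1 "[]"] ord by (simp add: rev_tm_def)
  moreover have "time (forward_pass C w P (rev ?ord)) \<le>
      2 + 4 * ?N + 5 * (C * ?N) + 5 * pc_size P"
    using ord by (intro time_forward_pass) simp_all
  moreover have "time (parent_lists P ?ord) \<le> 2 + 3 * ?N + 4 * pc_size P"
    using ord by (intro time_parent_lists)
  moreover have "time (backward_pass P (fw_table w) parent_table ?ord) \<le> 2 + 6 * ?N + 10 * pc_size P"
    using ord distinct_card[OF parent_table(1)] parent_table(2) by (intro time_backward_pass) simp_all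
  moreover have "time (gather_inputs P ?ord) \<le> 2 + 5 * ?N"
    using time_gather_inputs[of ?ord] ord by simp
  moreover have "time (read_out d C w P (fw_table w) (bk_table w) input_table) \<le>
      2 + 2 * d + 4 * (d * C) + 10 * (C * ?N)"
    using distinct_card[OF input_table(1)] input_table(2) by (intro time_read_out) simp
  ultimately have "time (forward_backward d C w P) \<le>
      16 + 26 * ?N + 25 * pc_size P + 2 * d + 4 * (d * C) + 15 * (C * ?N)"
    by simp
  \<comment> \<open>Products with \<open>C\<close> become the variables \<open>D\<close>,
    \<open>X\<close> and \<open>Y\<close>, which leaves linear arithmetic. Eliminating
    \<open>N\<close> gives the coefficients 51 for \<open>E\<close> and 48 for \<open>D\<close>, so
    80 is generous.\<close>
  moreover have "t \<le> 80 * (E + D) + 15 * Y"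
    if "t \<le> 16 + 26 * N + 25 * E + 2 * d + 4 * D + 15 * X" "X \<le> Y" "N \<le> E + D" "d \<le> D" "1 \<le> D"
    for t N E D X Y :: nat
    using that by simp
  moreover have "d \<le> d * C" "1 \<le> d * C" "C * ?N \<le> C * ?s"
    using C_pos d_pos card_nodes_le by (simp_all add: Suc_leI)
  ultimately have "time (forward_backward d C w P) \<le> 80 * ?s + 15 * (C * ?s)"
    using card_nodes_le by blast
  then show ?thesis
    by (simp add: algebra_simps)
qed

end

section \<open>Marginals\<close>

text \<open>An assignment to the variables of two disjoint sets is a pair of assignments, and each
  factor depends on its own set only.\<close>

lemma sum_PiE_Un:
  fixes g h :: "('a \<Rightarrow> 'b) \<Rightarrow> real"
  assumes "I \<inter> J = {}" "\<And>x. g (restrict x I) = g x" "\<And>x. h (restrict x J) = h x"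
  shows "(\<Sum>x\<in>I \<union> J \<rightarrow>\<^sub>E S. g x * h x) = (\<Sum>x\<in>I \<rightarrow>\<^sub>E S. g x) * (\<Sum>x\<in>J \<rightarrow>\<^sub>E S. h x)"
proof -
  \<comment> \<open>\<open>?m\<close> glues two partial assignments together; restriction to
    \<open>I\<close> and \<open>J\<close> inverts it.\<close>
  let ?m = "\<lambda>(x, y) i. if i \<in> I then x i else y i"
  have m: "restrict (?m (x, y)) I = x" "restrict (?m (x, y)) J = y"
    if "x \<in> I \<rightarrow>\<^sub>E S" "y \<in> J \<rightarrow>\<^sub>E S" for x y :: "'a \<Rightarrow> 'b"
    using that assms(1) by (auto simp: restrict_def PiE_def extensional_def fun_eq_iff)
  have "(\<Sum>x\<in>I \<rightarrow>\<^sub>E S. g x) * (\<Sum>x\<in>J \<rightarrow>\<^sub>E S. h x) = (\<Sum>(x, y)\<in>(I \<rightarrow>\<^sub>E S) \<times> (J \<rightarrow>\<^sub>E S). g x * h y)"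
    by (simp add: sum_product sum.cartesian_product)
  also have "\<dots> = (\<Sum>x\<in>I \<union> J \<rightarrow>\<^sub>E S. g x * h x)"
  proof (rule sum.reindex_bij_witness[where j = ?m and i = "\<lambda>x. (restrict x I, restrict x J)"], goal_cases)
    case (1 xy)
    then show ?case using m by auto
  next
    case (2 xy)
    then show ?case by (auto simp: PiE_def extensional_def)
  next
    case (3 x)
    then show ?case by (auto simp: PiE_def extensional_def fun_eq_iff)
  next
    case (4 x)
    then show ?case by auto
  next
    case (5 xy)
    then obtain x y where xy: "xy = (x, y)" "x \<in> I \<rightarrow>\<^sub>E S" "y \<in> J \<rightarrow>\<^sub>E S"
      by auto
    then show ?case
      using m[of x y] assms(2,3)[of "?m xy"] by simp
  qed
  finally show ?thesis ..
qed

locale smooth_decomposable_circuit = circuit +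
  assumes smooth: "smooth P" and decomposable: "decomposable P"
begin

lemma scope_sum_child:
  assumes "n \<in> nodes P" "node_at P n = Sum cs \<theta>" "c \<in> ch P n"
  shows "scope P c = scope P n"
proof -
  have "scope P c' = scope P c" if "c' \<in> ch P n" for c'
    using smooth assms that unfolding smooth_def by blast
  then have "(\<Union>c'\<in>ch P n. scope P c') = scope P c"
    using assms(3) by blast
  then show ?thesis
    using assms by (simp add: scope_unfold[of n])
qed

lemma scope_product_disjoint:
  assumes "n \<in> nodes P" "node_at P n = Product cs" "c \<in> ch P n" "c' \<in> ch P n" "c \<noteq> c'"
  shows "scope P c \<inter> scope P c' = {}"
  using decomposable assms unfolding decomposable_def by blast

text \<open>By decomposability the scopes of the children are disjoint, so the sum over joint
  assignments factors. The claim is about any subset \<open>A\<close> of the children to allow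
  induction.\<close>

lemma sum_product_children:
  fixes u :: "nat \<Rightarrow> nat \<Rightarrow> real"
  assumes n: "n \<in> nodes P" "node_at P n = Product cs" and A: "finite A" "A \<subseteq> ch P n"
  defines "ev \<equiv> \<lambda>x. node_value (\<lambda>i f. f (x i)) P"
  shows "(\<Sum>x\<in>(\<Union>c\<in>A. scope P c) \<rightarrow>\<^sub>E {..<C}. (\<Prod>i\<in>(\<Union>c\<in>A. scope P c). u i (x i)) * (\<Prod>c\<in>A. ev x c)) =
    (\<Prod>c\<in>A. \<Sum>x\<in>scope P c \<rightarrow>\<^sub>E {..<C}. (\<Prod>i\<in>scope P c. u i (x i)) * ev x c)"
  using A
proof (induction A)
  case (insert c A)
  let ?I = "scope P c" and ?J = "\<Union>c\<in>A. scope P c"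
  have ch: "c \<in> ch P n" "A \<subseteq> ch P n"
    using insert by auto
  then have nodes: "c \<in> nodes P" "A \<subseteq> nodes P"
    using n ch_in_nodes by auto
  have disj: "?I \<inter> ?J = {}"
    using scope_product_disjoint[OF n, of c] insert.hyps ch by blast
  \<comment> \<open>Values of \<open>x\<close> outside the scope do not matter; this provides the
    locality conditions of \<open>sum_PiE_Un\<close>.\<close>
  have ev: "ev (restrict x K) m = ev x m" if "m \<in> nodes P" "scope P m \<subseteq> K" for m K x
    unfolding ev_def by (rule node_value_cong) (use that in auto)
  let ?g = "\<lambda>x. (\<Prod>i\<in>?I. u i (x i)) * ev x c"
    and ?h = "\<lambda>x. (\<Prod>i\<in>?J. u i (x i)) * (\<Prod>c\<in>A. ev x c)"
  have "(\<Prod>i\<in>?I \<union> ?J. u i (x i)) * (\<Prod>c\<in>insert c A. ev x c) = ?g x * ?h x" for x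
  proof -
    have "finite ?I" "finite ?J"
      using nodes finite_scope insert.hyps by auto
    then show ?thesis
      using insert.hyps disj by (simp add: prod.union_disjoint)
  qed
  then have "(\<Sum>x\<in>?I \<union> ?J \<rightarrow>\<^sub>E {..<C}. (\<Prod>i\<in>?I \<union> ?J. u i (x i)) * (\<Prod>c\<in>insert c A. ev x c)) =
      (\<Sum>x\<in>?I \<union> ?J \<rightarrow>\<^sub>E {..<C}. ?g x * ?h x)"
    by (simp only:)
  also have "\<dots> = (\<Sum>x\<in>?I \<rightarrow>\<^sub>E {..<C}. ?g x) * (\<Sum>x\<in>?J \<rightarrow>\<^sub>E {..<C}. ?h x)"
  proof (rule sum_PiE_Un[OF disj])
    show "?g (restrict x ?I) = ?g x" for x
      using nodes ev[of c ?I x] by simp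
    have "ev (restrict x ?J) c = ev x c" if "c \<in> A" for c x
      using nodes that by (intro ev) auto
    then show "?h (restrict x ?J) = ?h x" for x
      by (intro arg_cong2[where f = "(*)"] prod.cong) simp_all
  qed
  finally show ?case
    using insert.IH[OF ch(2)] insert.hyps by (simp only: UN_insert prod.insert[OF insert.hyps(1,2)])
qed simp

text \<open>Each node sums over its own scope. Product nodes factor by decomposability; at a sum
  node, smoothness gives all children the same range of summation. The weights \<open>u\<close> are
  arbitrary to cover both \<open>w\<close> and its restriction to one value.\<close>

lemma sum_assignments_scope:
  assumes "n \<in> nodes P"
  shows "(\<Sum>x\<in>scope P n \<rightarrow>\<^sub>E {..<C}. (\<Prod>i\<in>scope P n. u i (x i)) * node_value (\<lambda>i f. f (x i)) P n) =
    node_value (\<lambda>i f. \<Sum>v<C. f v * u i v) P n"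
  using assms
proof (induction rule: node_induct)
  case (node n)
  show ?case
  proof (cases "node_at P n")
    case (Input i f)
    have "(\<Sum>x\<in>{i} \<rightarrow>\<^sub>E {..<C}. u i (x i) * f (x i)) = (\<Sum>v<C. f v * u i v)"
      by (rule sum.reindex_bij_witness[where i = "\<lambda>v. restrict (\<lambda>_. v) {i}" and j = "\<lambda>x. x i"])
        (auto simp: PiE_def extensional_def fun_eq_iff)
    then show ?thesis
      using node(1) Input by (simp add: scope_unfold node_value_eq)
  next
    case (Product cs)
    have "scope P n = (\<Union>c\<in>ch P n. scope P c)"
      using node(1) Product by (simp add: scope_unfold)
    then show ?thesis
      using sum_product_children[OF node(1) Product finite_ch order.refl, of u] node
      by (simp add: node_value_eq Product)
  next
    case (Sum cs \<theta>)
    let ?E = "scope P n \<rightarrow>\<^sub>E {..<C}"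
    have "(\<Sum>x\<in>?E. (\<Prod>i\<in>scope P n. u i (x i)) * node_value (\<lambda>i f. f (x i)) P n) =
        (\<Sum>x\<in>?E. \<Sum>c\<in>ch P n. \<theta> c * ((\<Prod>i\<in>scope P n. u i (x i)) * node_value (\<lambda>i f. f (x i)) P c))"
      using node(1) Sum by (simp add: node_value_eq[of n] sum_distrib_left mult_ac)
    also have "\<dots> = (\<Sum>c\<in>ch P n. \<theta> c *
        (\<Sum>x\<in>?E. (\<Prod>i\<in>scope P n. u i (x i)) * node_value (\<lambda>i f. f (x i)) P c))"
      by (subst sum.swap) (simp add: sum_distrib_left)
    also have "\<dots> = (\<Sum>c\<in>ch P n. \<theta> c * node_value (\<lambda>i f. \<Sum>v<C. f v * u i v) P c)"
      using node(2) scope_sum_child[OF node(1) Sum] by (intro sum.cong) auto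
    also have "\<dots> = node_value (\<lambda>i f. \<Sum>v<C. f v * u i v) P n"
      using node(1) Sum by (simp add: node_value_eq[of n])
    finally show ?thesis .
  qed
qed

lemma sum_assignments:
  "(\<Sum>x\<in>assignments d C. (\<Prod>i<d. u i (x i)) * prob P x) =
    node_value (\<lambda>i f. \<Sum>v<C. f v * u i v) P (root_at P)"
  using sum_assignments_scope[OF root_in_nodes, of u]
  by (simp add: scope_root assignments_def prob_def)

lemma norm_const_eq: "norm_const d C w P = fw_value C w P (root_at P)"
  by (simp add: norm_const_def sum_assignments fw_value_def)

end

section \<open>Marginals as quotients of forward values\<close>

text \<open>Zero weights on the other values of variable \<open>i\<close> turn a marginal into a sum
  over all assignments.\<close>

definition condition :: "nat \<Rightarrow> nat \<Rightarrow> (nat \<Rightarrow> nat \<Rightarrow> real) \<Rightarrow> nat \<Rightarrow> nat \<Rightarrow> real" where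
  "condition i v w j a = (if j = i \<and> a \<noteq> v then 0 else w j a)"

context smooth_decomposable_circuit
begin

lemma marginal_eq:
  assumes "i < d"
  shows "marginal d C (reweighted d C w P) i v =
    fw_value C (condition i v w) P (root_at P) / fw_value C w P (root_at P)"
proof -
  have fin: "finite (assignments d C)"
    by (simp add: assignments_def finite_PiE)
  \<comment> \<open>Since \<open>i < d\<close>, the product contains the factor for
    \<open>i\<close>, which vanishes unless \<open>x i = v\<close>.\<close>
  have *: "(\<Prod>j<d. condition i v w j (x j)) = (if x i = v then \<Prod>j<d. w j (x j) else 0)" for x
    using assms by (auto simp: condition_def intro!: prod.cong prod_zero)
  have "marginal d C (reweighted d C w P) i v =
      (\<Sum>x\<in>{x \<in> assignments d C. x i = v}. (\<Prod>j<d. condition i v w j (x j)) * prob P x) /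
      norm_const d C w P"
    by (simp add: marginal_def reweighted_def * sum_divide_distrib)
  also have "(\<Sum>x\<in>{x \<in> assignments d C. x i = v}. (\<Prod>j<d. condition i v w j (x j)) * prob P x) =
      (\<Sum>x\<in>assignments d C. (\<Prod>j<d. condition i v w j (x j)) * prob P x)"
    by (rule sum.mono_neutral_left) (auto simp: fin *)
  finally show ?thesis
    by (simp add: sum_assignments norm_const_eq fw_value_def)
qed

lemma fw_condition_outside_scope:
  "n \<in> nodes P \<Longrightarrow> i \<notin> scope P n \<Longrightarrow> fw_value C (condition i v w) P n = fw_value C w P n"
  unfolding fw_value_def by (rule node_value_cong) (auto simp: condition_def intro!: sum.cong)

lemma fw_condition_input:
  assumes "n \<in> nodes P" "node_at P n = Input i f" "v < C"
  shows "fw_value C (condition i v w) P n = f v * w i v"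
proof -
  have "fw_value C (condition i v w) P n = (\<Sum>a<C. if a = v then f v * w i v else 0)"
    unfolding fw_value_def node_value_eq[OF assms(1)] assms(2) node.case
    by (rule sum.cong) (simp_all add: condition_def)
  then show ?thesis
    using assms(3) by simp
qed

text \<open>Sums and products with non-negative parameters are monotone in non-negative values at
  the input nodes.\<close>

lemma fw_condition_bounds:
  assumes w: "\<And>i v. i < d \<Longrightarrow> v < C \<Longrightarrow> 0 \<le> w i v" and "n \<in> nodes P"
  shows "0 \<le> fw_value C (condition i v w) P n \<and>
    fw_value C (condition i v w) P n \<le> fw_value C w P n"
  using assms(2)
proof (induction rule: node_induct)
  case (node n)
  show ?case
  proof (cases "node_at P n")
    case (Input j f)
    have "0 \<le> f a * condition i v w j a \<and> f a * condition i v w j a \<le> f a * w j a" if "a < C" for a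
      using that w[of j a] valid_node[OF node(1)] input_var_less[OF node(1) Input]
      by (auto simp: Input condition_def)
    then show ?thesis
      using node(1) Input by (auto simp: fw_value_def node_value_eq intro!: sum_mono sum_nonneg)
  next
    case (Product cs)
    then show ?thesis
      using node by (auto simp: fw_value_def node_value_eq intro!: prod_mono prod_nonneg)
  next
    case (Sum cs \<theta>)
    then have "0 \<le> \<theta> c" if "c \<in> ch P n" for c
      using that valid_node[OF node(1)] by (simp add: ch_def)
    then show ?thesis
      using node Sum
      by (auto simp: fw_value_def node_value_eq[of n] intro!: sum_mono sum_nonneg mult_left_mono)
  qed
qed

end

section \<open>Correctness of the backward pass\<close>

locale alternating_circuit = smooth_decomposable_circuit +
  assumes alternating: "alternating P"
begin

lemma no_clash: "m \<in> nodes P \<Longrightarrow> n \<in> ch P m \<Longrightarrow> \<not> clash (node_at P m) (node_at P n)"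
  using alternating by (auto simp: alternating_def edges_iff)

text \<open>With the share of \<open>bk\<^sub>m\<close> that an edge passes on, the two cases of the backward recursion
  become one.\<close>

definition share :: "(nat \<Rightarrow> real) \<Rightarrow> nat \<Rightarrow> nat \<Rightarrow> real" where
  "share fw m n = (case node_at P m of Sum cs \<theta> \<Rightarrow> \<theta> n * fw n / fw m | _ \<Rightarrow> 1)"

text \<open>In an alternating circuit a parent of a product node is a sum node, and a parent of any
  other node is a product node, whose share is 1.\<close>

lemma backward_share:
  assumes "n \<in> nodes P"
  shows "(case node_at P n of
       Product cs \<Rightarrow> (\<Sum>m\<in>parents n. param (node_at P m) n * fw n / fw m * bk m)
     | _ \<Rightarrow> (\<Sum>m\<in>parents n. bk m)) = (\<Sum>m\<in>parents n. share fw m n * bk m)"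
proof -
  have nc: "\<not> clash (node_at P m) (node_at P n) \<and> children_of (node_at P m) \<noteq> []" if "m \<in> parents n" for m
    using that no_clash by (auto simp: parents_def ch_def)
  show ?thesis
  proof (cases "node_at P n")
    case (Product cs)
    have "param (node_at P m) n * fw n / fw m * bk m = share fw m n * bk m" if "m \<in> parents n" for m
      using nc[OF that] Product by (cases "node_at P m") (auto simp: share_def)
    then show ?thesis
      using Product by simp
  next
    case (Input i f)
    have "share fw m n = 1" if "m \<in> parents n" for m
      using nc[OF that] Input by (cases "node_at P m") (auto simp: share_def)
    then show ?thesis
      using Input by simp
  next
    case (Sum cs \<theta>)
    have "share fw m n = 1" if "m \<in> parents n" for m
      using nc[OF that] Sum by (cases "node_at P m") (auto simp: share_def)
    then show ?thesis
      using Sum by simp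
  qed
qed

section \<open>The telescoping sum for one variable and one value\<close>

text \<open>The tables are abstracted to functions with the equations they satisfy. The condition on
  the weights enters through \<open>F_zero\<close>, which follows from either alternative.\<close>

context
  fixes w :: "nat \<Rightarrow> nat \<Rightarrow> real" and i v :: nat and bk fw F :: "nat \<Rightarrow> real"
  assumes i: "i < d"
    and fw: "\<And>n. n \<in> nodes P \<Longrightarrow> fw n = fw_value C w P n"
    and bk_root: "bk (root_at P) = 1"
    and bk: "\<And>n. n \<in> nodes P \<Longrightarrow> n \<noteq> root_at P \<Longrightarrow> bk n = (\<Sum>m\<in>parents n. share fw m n * bk m)"
    and fw_root: "fw (root_at P) \<noteq> 0"
    and F_zero: "\<And>n. n \<in> nodes P \<Longrightarrow> fw n = 0 \<Longrightarrow> F n = 0"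
    and F_eq: "F = fw_value C (condition i v w) P"
begin

text \<open>All parents are sum nodes, whose shares carry the factor \<open>fw n\<close>;
  \<open>n\<close> is not the root, where \<open>fw\<close> does not vanish.\<close>

lemma bk_product_zero:
  assumes "n \<in> nodes P" "node_at P n = Product cs" "fw n = 0"
  shows "bk n = 0"
proof -
  have "share fw m n = 0" if "m \<in> parents n" for m
    using that assms no_clash[of m n]
    by (cases "node_at P m") (auto simp: share_def parents_def ch_def)
  then show ?thesis
    using assms bk[of n] fw_root by auto
qed

text \<open>Conservation of flow at \<open>m\<close>. Nothing leaves an input node, which has no
  children, and no child has \<open>i\<close> in its scope if \<open>m\<close> does not.\<close>

lemma sum_shares:
  assumes m: "m \<in> nodes P"
  shows "(\<Sum>n\<in>{n \<in> ch P m. i \<in> scope P n}. share fw m n * bk m * (F n / fw n)) =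
    (if i \<in> scope P m \<and> m \<notin> inputs i then bk m * (F m / fw m) else 0)"
proof (cases "i \<in> scope P m")
  case False
  then have no_child: "{n \<in> ch P m. i \<in> scope P n} = {}"
    using scope_child[OF m] by auto
  show ?thesis
    unfolding no_child using False by simp
next
  case True
  show ?thesis
  proof (cases "node_at P m")
    case (Input j f)
    then show ?thesis
      using m True by (auto simp: ch_def inputs_def scope_unfold)
  next
    case (Product cs)
    obtain c where c: "c \<in> ch P m" "i \<in> scope P c"
      using True Product m by (auto simp: scope_unfold[of m])
    \<comment> \<open>Disjoint scopes single out \<open>c\<close> as the only child with variable
      \<open>i\<close>.\<close>
    have others: "i \<notin> scope P n" if "n \<in> ch P m - {c}" for n
      using scope_product_disjoint[OF m Product c(1), of n] that c by auto
    then have "{n \<in> ch P m. i \<in> scope P n} = {c}"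
      using c by auto
    moreover have "bk m * (F c / fw c) = bk m * (F m / fw m)"
    \<comment> \<open>Cancelling the factors of the other children requires \<open>fw m\<close> to
      be non-zero; otherwise \<open>bk m = 0\<close> settles both sides.\<close>
    proof (cases "fw m = 0")
      case True
      then show ?thesis
        using bk_product_zero[OF m Product] by simp
    next
      case False
      let ?r = "\<Prod>n\<in>ch P m - {c}. fw n"
      have "F n = fw n" if "n \<in> ch P m - {c}" for n
        using others[OF that] that m ch_in_nodes fw
        by (simp add: F_eq fw_condition_outside_scope)
      then have "F m = F c * ?r"
        using m Product c by (simp add: F_eq fw_value_def node_value_eq[of m] prod.remove finite_ch)
      moreover have "fw m = (\<Prod>n\<in>ch P m. fw n)"
        using m Product fw ch_in_nodes by (simp add: fw_value_def node_value_eq[of m])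
      then have "fw m = fw c * ?r"
        using c by (simp add: prod.remove finite_ch)
      ultimately show ?thesis
        using False by simp
    qed
    ultimately show ?thesis
      using True Product by (simp add: share_def inputs_def)
  next
    case (Sum cs \<theta>)
    have "{n \<in> ch P m. i \<in> scope P n} = ch P m"
      using scope_sum_child[OF m Sum] True by auto
    \<comment> \<open>The factor \<open>fw n\<close> of the share cancels against the quotient; if
      it is 0, then so is \<open>F n\<close>.\<close>
    moreover have "share fw m n * bk m * (F n / fw n) = bk m / fw m * (\<theta> n * F n)" if "n \<in> ch P m" for n
      using F_zero[of n] that m ch_in_nodes Sum by (cases "fw n = 0") (auto simp: share_def)
    moreover have "F m = (\<Sum>n\<in>ch P m. \<theta> n * F n)"
      using m Sum by (simp add: F_eq fw_value_def node_value_eq[of m])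
    ultimately show ?thesis
      using True Sum by (simp add: sum_distrib_left sum_divide_distrib inputs_def)
  qed
qed

lemma sum_inputs: "(\<Sum>n\<in>inputs i. bk n * (F n / fw n)) = F (root_at P) / fw (root_at P)"
proof -
  let ?r = "root_at P"
  let ?N = "{n \<in> nodes P. i \<in> scope P n}"
  let ?b = "\<lambda>n. bk n * (F n / fw n)"
  have fin: "finite ?N"
    by (simp add: finite_nodes)
  have inputs: "inputs i \<subseteq> ?N"
    by (auto simp: inputs_def scope_unfold)
  have "?r \<in> ?N"
    using i scope_root root_in_nodes by simp
  then have "(\<Sum>n\<in>?N. ?b n) = ?b ?r + (\<Sum>n\<in>?N - {?r}. ?b n)"
    by (simp add: sum.remove fin)
  also have "(\<Sum>n\<in>?N - {?r}. ?b n) =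
      (\<Sum>n\<in>?N - {?r}. \<Sum>m\<in>{m \<in> nodes P. n \<in> ch P m}. share fw m n * bk m * (F n / fw n))"
  proof (rule sum.cong[OF refl])
    fix n assume "n \<in> ?N - {?r}"
    then have bk_n: "bk n = (\<Sum>m\<in>{m \<in> nodes P. n \<in> ch P m}. share fw m n * bk m)"
      using bk by (simp add: parents_def)
    show "?b n = (\<Sum>m\<in>{m \<in> nodes P. n \<in> ch P m}. share fw m n * bk m * (F n / fw n))"
      by (simp only: bk_n sum_distrib_right)
  qed
  \<comment> \<open>Exchanging the sums collects at each \<open>m\<close> everything that it passes
    on.\<close>
  also have "\<dots> = (\<Sum>m\<in>nodes P. \<Sum>n\<in>{n \<in> ?N - {?r}. n \<in> ch P m}. share fw m n * bk m * (F n / fw n))"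
    by (rule sum.swap_restrict) (simp_all add: finite_nodes)
  also have "\<dots> = (\<Sum>m\<in>nodes P. if i \<in> scope P m \<and> m \<notin> inputs i then ?b m else 0)"
  proof (rule sum.cong[OF refl])
    fix m assume m: "m \<in> nodes P"
    then have "{n \<in> ?N - {?r}. n \<in> ch P m} = {n \<in> ch P m. i \<in> scope P n}"
      using ch_in_nodes root_not_child by auto
    then show "(\<Sum>n\<in>{n \<in> ?N - {?r}. n \<in> ch P m}. share fw m n * bk m * (F n / fw n)) =
        (if i \<in> scope P m \<and> m \<notin> inputs i then ?b m else 0)"
      using sum_shares[OF m] by simp
  qed
  also have "\<dots> = (\<Sum>m\<in>?N - inputs i. ?b m)"
    by (rule sum.mono_neutral_cong_right) (auto simp: finite_nodes)
  finally have "(\<Sum>n\<in>?N. ?b n) = ?b ?r + (\<Sum>m\<in>?N - inputs i. ?b m)" .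
  \<comment> \<open>The nodes outside \<open>inputs i\<close> occur on both sides and cancel,
    leaving the input nodes and the root.\<close>
  moreover have "(\<Sum>n\<in>?N. ?b n) = (\<Sum>m\<in>?N - inputs i. ?b m) + (\<Sum>n\<in>inputs i. ?b n)"
    by (rule sum.subset_diff[OF inputs fin])
  ultimately show ?thesis
    by (simp add: bk_root)
qed

end

lemma forward_backward_correct:
  assumes Z: "norm_const d C w P \<noteq> 0"
    and w: "(\<forall>i<d. \<forall>v<C. 0 \<le> w i v) \<or> (\<forall>n\<in>nodes P. fw_value C w P n \<noteq> 0)"
    and iv: "i < d" "v < C"
  shows "val (forward_backward d C w P) i v = marginal d C (reweighted d C w P) i v"
proof -
  let ?F = "fw_value C (condition i v w) P"
  have bk_root: "bk_table w (root_at P) = 1"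
    by (simp add: bk_table_unfold root_in_nodes)
  have bk: "bk_table w n = (\<Sum>m\<in>parents n. share (fw_table w) m n * bk_table w m)"
    if "n \<in> nodes P" "n \<noteq> root_at P" for n
    using bk_table_unfold[OF that(1), of w] that(2) backward_share[OF that(1)] by simp
  have fw_root: "fw_table w (root_at P) \<noteq> 0"
    using Z by (simp add: fw_table root_in_nodes norm_const_eq)
  \<comment> \<open>Under the second alternative no \<open>fw_table w n\<close> is 0; under the
    first, \<open>?F n\<close> lies between 0 and \<open>fw_table w n\<close>.\<close>
  have F_zero: "?F n = 0" if "n \<in> nodes P" "fw_table w n = 0" for n
    using w fw_condition_bounds[of w n i v] that by (auto simp: fw_table)
  have "val (forward_backward d C w P) i v = (\<Sum>n\<in>inputs i. bk_table w n * (?F n / fw_table w n))"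
    using iv by (auto simp: val_forward_backward inputs_def fw_condition_input intro!: sum.cong)
  also have "\<dots> = ?F (root_at P) / fw_table w (root_at P)"
    by (rule sum_inputs[OF iv(1) fw_table bk_root bk fw_root F_zero refl])
  also have "\<dots> = marginal d C (reweighted d C w P) i v"
    by (simp add: marginal_eq iv fw_table root_in_nodes)
  finally show ?thesis .
qed

end

section \<open>Conversion into an alternating circuit\<close>

text \<open>\<open>target\<close> and \<open>add_dummy\<close> are the two results of
  \<open>link\<close> as pure functions, which makes the conversion a plain fold.\<close>

definition target :: "pc \<Rightarrow> node \<Rightarrow> nat \<Rightarrow> nat" where
  "target P k c = (if clash k (node_at P c) then 2 * c + 1 else 2 * c)"

definition add_dummy :: "pc \<Rightarrow> node \<Rightarrow> nat \<Rightarrow> (nat \<Rightarrow> node) \<Rightarrow> nat \<Rightarrow> node" where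
  "add_dummy P k c M =
     (if clash k (node_at P c) then M(2 * c + 1 := dummy (2 * c) (node_at P c)) else M)"

text \<open>The child lists come out reversed because the loop prepends.\<close>

fun convert :: "pc \<Rightarrow> node \<Rightarrow> node" where
  "convert P (Input i f) = Input i f"
| "convert P (Product cs) = Product (rev (map (target P (Product cs)) cs))"
| "convert P (Sum cs \<theta>) = Sum (rev (map (target P (Sum cs \<theta>)) cs))
     (fold (\<lambda>c \<theta>'. \<theta>'(target P (Sum cs \<theta>) c := \<theta> c)) cs (\<lambda>_. 0))"

definition convert_step :: "pc \<Rightarrow> nat \<Rightarrow> (nat \<Rightarrow> node) \<Rightarrow> nat \<Rightarrow> node" where
  "convert_step P n M = (fold (add_dummy P (node_at P n)) (children_of (node_at P n)) M)
     (2 * n := convert P (node_at P n))"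

lemma target_div_2 [simp]: "target P k c div 2 = c"
  by (simp add: target_def)

text \<open>Halving recovers the original child. Hence converted children stay distinct and their
  parameters do not overwrite each other.\<close>

lemma inj_on_target: "inj_on (target P k) A"
  by (metis inj_onI target_div_2)

lemma val_link: "val (link P k c M) = (target P k c, add_dummy P k c M)"
  by (simp add: link_def target_def add_dummy_def)

lemma time_link: "time (link P k c M) \<le> 6"
  by (simp add: link_def)

lemma fold_pair:
  "fold (\<lambda>c s. (t c # fst s, a c (snd s))) cs (xs, M) = (rev (map t cs) @ xs, fold a cs M)"
  by (induction cs arbitrary: xs M) simp_all

lemma fold_triple:
  "fold (\<lambda>c s. (t c # fst s, (fst (snd s))(t c := h c), a c (snd (snd s)))) cs (xs, f, M) =
    (rev (map t cs) @ xs, fold (\<lambda>c f. f(t c := h c)) cs f, fold a cs M)"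
  by (induction cs arbitrary: xs f M) simp_all

lemma fold_upd_image:
  assumes "inj t" "c \<in> set cs"
  shows "fold (\<lambda>c f. f(t c := h c)) cs f (t c) = h c"
proof -
  have other: "fold (\<lambda>c f. f(t c := h c)) cs f (t a) = f (t a)" if "a \<notin> set cs" for cs f a
    using that by (induction cs arbitrary: f) (auto simp: inj_eq[OF assms(1)])
  show ?thesis
    using assms(2)
  proof (induction cs arbitrary: f)
    case (Cons b cs)
    then show ?case
      by (cases "c \<in> set cs") (auto simp: other fun_upd_same simp del: fun_upd_apply)
  qed simp
qed

lemma val_make_alternating:
  "val (make_alternating P) = \<lparr>root_at = 2 * root_at P,
     node_at = fold (convert_step P) (val (preorder P)) (\<lambda>_. Product [])\<rparr>"
  unfolding make_alternating_def val_bind val_op val_for_each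
  by (rule arg_cong2[where f = "\<lambda>r k. \<lparr>root_at = r, node_at = k\<rparr>", OF refl],
      rule fold_cong[OF refl refl], rule ext)
    (auto simp: convert_step_def split_beta val_link fold_pair fold_triple split: node.split)

lemma fold_add_dummy_even: "fold (add_dummy P k) cs M (2 * n) = M (2 * n)"
  by (induction cs arbitrary: M) (auto simp: add_dummy_def double_not_eq_Suc_double)

lemma fold_add_dummy_odd:
  "fold (add_dummy P k) cs M (2 * c + 1) =
    (if c \<in> set cs \<and> clash k (node_at P c) then dummy (2 * c) (node_at P c) else M (2 * c + 1))"
  by (induction cs arbitrary: M) (auto simp: add_dummy_def)

lemma fold_convert_step_even:
  "fold (convert_step P) ns M (2 * n) = (if n \<in> set ns then convert P (node_at P n) else M (2 * n))"
  by (induction ns arbitrary: M) (auto simp: convert_step_def fold_add_dummy_even)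

text \<open>Several parents may write the dummy of \<open>c\<close>, but always with the same
  content, and converted nodes go to even addresses.\<close>

lemma fold_convert_step_odd:
  "fold (convert_step P) ns M (2 * c + 1) =
    (if \<exists>m\<in>set ns. c \<in> ch P m \<and> clash (node_at P m) (node_at P c)
     then dummy (2 * c) (node_at P c) else M (2 * c + 1))"
proof (induction ns arbitrary: M)
  case (Cons n ns)
  have "convert_step P n M (2 * c + 1) =
      (if c \<in> ch P n \<and> clash (node_at P n) (node_at P c)
       then dummy (2 * c) (node_at P c) else M (2 * c + 1))"
    using fold_add_dummy_odd[of P "node_at P n" "children_of (node_at P n)" M c]
      Suc_double_not_eq_double[of c n]
    by (simp add: convert_step_def ch_def)
  then show ?case
    using Cons[of "convert_step P n M"] by auto
qed simp

lemma clash_convert: "clash (convert P k) (convert P k') = clash k k'"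
  by (cases k; cases k') simp_all

text \<open>A product node clashes only with a product parent and gets a sum dummy; the other nodes
  clash only with a sum parent and get a product dummy.\<close>

lemma clash_into_dummy: "clash k k' \<Longrightarrow> \<not> clash (convert P k) (dummy a k')"
  by (cases k; cases k') (simp_all add: dummy_def)

lemma clash_from_dummy: "\<not> clash (dummy a k) (convert P k)"
  by (cases k) (simp_all add: dummy_def)

lemma children_of_dummy: "children_of (dummy a k) = [a]"
  by (cases k) (simp_all add: dummy_def)

lemma children_of_convert: "set (children_of (convert P k)) = target P k ` set (children_of k)"
  by (cases k) simp_all

lemma convert_param:
  "node_at P n = Sum cs \<theta> \<Longrightarrow> \<exists>\<theta>'. convert P (node_at P n) =
     Sum (rev (map (target P (node_at P n)) cs)) \<theta>' \<and> (\<forall>c\<in>set cs. \<theta>' (target P (node_at P n) c) = \<theta> c)"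
  by (simp add: fold_upd_image[OF inj_on_target])

lemma valid_node_convert: "valid_node C k \<Longrightarrow> valid_node C (convert P k)"
proof (cases k)
  case (Sum cs \<theta>)
  assume "valid_node C k"
  then show ?thesis
    by (auto simp: Sum distinct_map inj_on_target sum.reindex fold_upd_image[OF inj_on_target])
qed (auto simp: distinct_map inj_on_target)

lemma valid_node_dummy: "valid_node C (dummy a k)"
  by (cases k) (simp_all add: dummy_def)

section \<open>Nodes, edges and size of the converted circuit\<close>

context circuit
begin

abbreviation P' :: pc where
  "P' \<equiv> val (make_alternating P)"

definition needs_dummy :: "nat set" where
  "needs_dummy = {c. \<exists>m\<in>nodes P. c \<in> ch P m \<and> clash (node_at P m) (node_at P c)}"

lemma needs_dummy_nodes: "c \<in> needs_dummy \<Longrightarrow> c \<in> nodes P"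
  by (auto simp: needs_dummy_def ch_in_nodes)

lemma root_P': "root_at P' = 2 * root_at P"
  by (simp add: val_make_alternating)

lemma node_at_even: "n \<in> nodes P \<Longrightarrow> node_at P' (2 * n) = convert P (node_at P n)"
  by (simp add: val_make_alternating fold_convert_step_even set_preorder)

lemma node_at_odd: "c \<in> needs_dummy \<Longrightarrow> node_at P' (2 * c + 1) = dummy (2 * c) (node_at P c)"
  unfolding val_make_alternating pc.select_convs fold_convert_step_odd
  by (simp add: needs_dummy_def set_preorder)

lemma ch_even: "n \<in> nodes P \<Longrightarrow> ch P' (2 * n) = target P (node_at P n) ` ch P n"
  by (simp add: ch_def node_at_even children_of_convert)

lemma ch_odd: "c \<in> needs_dummy \<Longrightarrow> ch P' (2 * c + 1) = {2 * c}"
  unfolding ch_def node_at_odd children_of_dummy by simp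

lemma target_cases:
  assumes "n \<in> nodes P" "c \<in> ch P n"
  obtains "c \<in> needs_dummy" "clash (node_at P n) (node_at P c)" "target P (node_at P n) c = 2 * c + 1"
  | "\<not> clash (node_at P n) (node_at P c)" "target P (node_at P n) c = 2 * c"
  using assms by (auto simp: needs_dummy_def target_def)

lemma nodes_P'_cases:
  assumes "n' \<in> nodes P'"
  obtains n where "n \<in> nodes P" "n' = 2 * n" | c where "c \<in> needs_dummy" "n' = 2 * c + 1"
proof -
  have "(\<exists>n\<in>nodes P. n' = 2 * n) \<or> (\<exists>c\<in>needs_dummy. n' = 2 * c + 1)"
    using assms
  proof (induction rule: nodes_induct)
    case root
    then show ?case
      by (simp add: root_P' root_in_nodes)
  next
    case (child m c)
    then consider n where "n \<in> nodes P" "m = 2 * n" | b where "b \<in> needs_dummy" "m = 2 * b + 1"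
      by blast
    then show ?case
    proof cases
      case (1 n)
      then obtain a where a: "a \<in> ch P n" "c = target P (node_at P n) a"
        using child ch_even by auto
      then show ?thesis
        using 1 ch_in_nodes[of n P a] by (cases rule: target_cases[OF 1(1) a(1)]) auto
    next
      case (2 b)
      then show ?thesis
        using child.hyps ch_odd[of b] needs_dummy_nodes by auto
    qed
  qed
  then show thesis
    using that by blast
qed

lemma even_in_nodes: "n \<in> nodes P \<Longrightarrow> 2 * n \<in> nodes P'"
proof (induction rule: nodes_induct)
  case root
  then show ?case
    using root_in_nodes[of P'] by (simp add: root_P')
next
  case (child m c)
  then have target: "target P (node_at P m) c \<in> nodes P'"
    by (auto intro: ch_in_nodes simp: ch_even)
  show ?case
    using child.hyps
  proof (cases rule: target_cases)
    case 1
    then show ?thesis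
      using target ch_odd[of c] ch_in_nodes[of "2 * c + 1" P' "2 * c"] by simp
  next
    case 2
    then show ?thesis
      using target by simp
  qed
qed

lemma odd_in_nodes:
  assumes "c \<in> needs_dummy"
  shows "2 * c + 1 \<in> nodes P'"
proof -
  obtain m where m: "m \<in> nodes P" "c \<in> ch P m" "clash (node_at P m) (node_at P c)"
    using assms by (auto simp: needs_dummy_def)
  then have "target P (node_at P m) c \<in> ch P' (2 * m)"
    by (simp add: ch_even)
  then have "target P (node_at P m) c \<in> nodes P'"
    using m(1) ch_in_nodes even_in_nodes by blast
  then show ?thesis
    using m by (simp add: target_def)
qed

text \<open>An edge yields its converted copy and at most the one edge below a dummy, which all
  clashing edges into the same node share. This gives the factor 2 in the size.\<close>

lemma edges_P':
  "edges P' \<subseteq> (\<lambda>(m, c). (2 * m, target P (node_at P m) c)) ` edges P \<union>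
    (\<lambda>(m, c). (2 * c + 1, 2 * c)) ` edges P"
proof
  fix e assume "e \<in> edges P'"
  then obtain m' c' where e: "e = (m', c')" "m' \<in> nodes P'" "c' \<in> ch P' m'"
    by (auto simp: edges_def)
  from e(2) show "e \<in> (\<lambda>(m, c). (2 * m, target P (node_at P m) c)) ` edges P \<union>
    (\<lambda>(m, c). (2 * c + 1, 2 * c)) ` edges P"
  proof (cases rule: nodes_P'_cases)
    case (1 n)
    then obtain c where "c \<in> ch P n" "c' = target P (node_at P n) c"
      using e ch_even by auto
    then show ?thesis
      using 1 e by (intro UnI1 image_eqI[of _ _ "(n, c)"]) (simp_all add: edges_iff)
  next
    case (2 c)
    then obtain m where "(m, c) \<in> edges P"
      by (auto simp: needs_dummy_def edges_iff)
    then show ?thesis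
      using e 2 ch_odd[of c] by (intro UnI2 image_eqI[of _ _ "(m, c)"]) simp_all
  qed
qed

lemma pc_size_P': "pc_size P' \<le> 2 * pc_size P"
proof -
  let ?A = "(\<lambda>(m, c). (2 * m, target P (node_at P m) c)) ` edges P"
    and ?B = "(\<lambda>(m, c). (2 * c + 1, 2 * c)) ` edges P"
  have "card (edges P') \<le> card (?A \<union> ?B)"
    by (intro card_mono edges_P') (simp add: finite_edges)
  also have "\<dots> \<le> card ?A + card ?B"
    by (rule card_Un_le)
  also have "\<dots> \<le> card (edges P) + card (edges P)"
    by (intro add_mono card_image_le finite_edges)
  finally show ?thesis
    by (simp add: pc_size_def)
qed

lemma acyclic_P': "acyclic (edges P')"
proof -
  \<comment> \<open>A converted edge moves to a child in \<open>P\<close> after halving; the edge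
    below a dummy keeps the half and lowers the parity from 1 to 0.\<close>
  have "(edges P')\<inverse> \<subseteq> inv_image ((edges P)\<inverse> <*lex*> less_than) (\<lambda>n. (n div 2, n mod 2))"
    using edges_P' by auto
  moreover have "wf (inv_image ((edges P)\<inverse> <*lex*> less_than) (\<lambda>n. (n div 2, n mod 2)))"
    by (intro wf_inv_image wf_lex_prod wf_edges_converse wf_less_than)
  ultimately have "wf ((edges P')\<inverse>)"
    using wf_subset by blast
  then show ?thesis
    using wf_acyclic acyclic_converse by blast
qed

section \<open>Meaning and structure of the converted circuit\<close>

lemma scope_odd: "c \<in> needs_dummy \<Longrightarrow> scope P' (2 * c + 1) = scope P' (2 * c)"
  using scope_unfold[OF odd_in_nodes, of c] node_at_odd[of c] ch_odd[of c]
  by (cases "node_at P c") (simp_all add: dummy_def)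

lemma scope_even: "n \<in> nodes P \<Longrightarrow> scope P' (2 * n) = scope P n"
proof (induction rule: node_induct)
  case (node n)
  have "scope P' (target P (node_at P n) c) = scope P c" if "c \<in> ch P n" for c
    by (rule target_cases[OF node(1) that]) (simp_all add: node(2) that scope_odd[simplified])
  then have "(\<Union>c\<in>ch P' (2 * n). scope P' c) = (\<Union>c\<in>ch P n. scope P c)"
    using node(1) by (simp add: ch_even)
  then show ?case
    using scope_unfold[OF even_in_nodes[OF node(1)]] node(1)
    by (cases "node_at P n") (simp_all add: node_at_even scope_unfold)
qed

lemma scope_target: "n \<in> nodes P \<Longrightarrow> c \<in> ch P n \<Longrightarrow> scope P' (target P (node_at P n) c) = scope P c"
  by (rule target_cases) (auto simp: ch_in_nodes scope_odd[simplified] scope_even)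

lemma is_pc_P': "is_pc d C P'"
  unfolding is_pc_def
proof (intro conjI ballI)
  have "nodes P' \<subseteq> (\<lambda>n. 2 * n) ` nodes P \<union> (\<lambda>n. 2 * n + 1) ` nodes P"
    using nodes_P'_cases needs_dummy_nodes by blast
  then show "finite (nodes P')"
    by (rule finite_subset) (simp add: finite_nodes)
  show "acyclic (edges P')"
    by (rule acyclic_P')
  show "scope P' (root_at P') = {..<d}"
    by (simp add: root_P' scope_even root_in_nodes scope_root)
  show "valid_node C (node_at P' n)" if "n \<in> nodes P'" for n
    using that
  proof (cases rule: nodes_P'_cases)
    case (1 m)
    then show ?thesis
      by (simp add: node_at_even valid_node valid_node_convert)
  next
    case (2 c)
    then show ?thesis
      using node_at_odd[of c] valid_node_dummy by simp
  qed
qed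

lemmas node_value_P' = node_value_unfold[OF is_pc_P']

text \<open>A dummy is a product of one factor or a sum with the single parameter 1. As
  \<open>leaf\<close> is arbitrary, this covers probabilities and forward values alike.\<close>

lemma node_value_odd:
  "c \<in> needs_dummy \<Longrightarrow> node_value leaf P' (2 * c + 1) = node_value leaf P' (2 * c)"
  using node_value_P'[OF odd_in_nodes, of c leaf] node_at_odd[of c] ch_odd[of c]
  by (cases "node_at P c") (simp_all add: dummy_def)

lemma node_value_even: "n \<in> nodes P \<Longrightarrow> node_value leaf P' (2 * n) = node_value leaf P n"
proof (induction rule: node_induct)
  case (node n)
  let ?t = "target P (node_at P n)"
  have target: "node_value leaf P' (?t c) = node_value leaf P c" if "c \<in> ch P n" for c
    by (rule target_cases[OF node(1) that]) (simp_all add: node(2) that node_value_odd[simplified])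
  note unfold = node_value_P'[OF even_in_nodes[OF node(1)], of leaf] node_at_even[OF node(1)]
    node_value_eq[OF node(1), of leaf] ch_even[OF node(1)]
  show ?case
  proof (cases "node_at P n")
    case (Input i f)
    then show ?thesis
      by (simp add: unfold)
  next
    case (Product cs)
    have "(\<Prod>c\<in>?t ` ch P n. node_value leaf P' c) = (\<Prod>c\<in>ch P n. node_value leaf P c)"
      by (simp add: prod.reindex[OF inj_on_target] target)
    then show ?thesis
      using Product by (simp add: unfold)
  next
    case (Sum cs \<theta>)
    obtain \<theta>' where \<theta>': "convert P (node_at P n) = Sum (rev (map ?t cs)) \<theta>'"
        "\<forall>c\<in>set cs. \<theta>' (?t c) = \<theta> c"
      using convert_param[OF Sum] by blast
    have "(\<Sum>c\<in>?t ` ch P n. \<theta>' c * node_value leaf P' c) = (\<Sum>c\<in>ch P n. \<theta> c * node_value leaf P c)"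
      unfolding sum.reindex[OF inj_on_target] o_def
    proof (rule sum.cong[OF refl])
      fix c assume "c \<in> ch P n"
      moreover from this have "c \<in> set cs"
        using Sum by (simp add: ch_def)
      ultimately show "\<theta>' (?t c) * node_value leaf P' (?t c) = \<theta> c * node_value leaf P c"
        using \<theta>'(2) target by simp
    qed
    then show ?thesis
      using Sum \<theta>'(1) by (simp add: unfold del: convert.simps)
  qed
qed

lemma prob_P': "prob P' x = prob P x"
  by (simp add: prob_def root_P' node_value_even root_in_nodes)

lemma norm_const_P': "norm_const d C w P' = norm_const d C w P"
  by (simp add: norm_const_def prob_P')

lemma reweighted_P': "reweighted d C w P' = reweighted d C w P"
  by (simp add: reweighted_def fun_eq_iff prob_P' norm_const_P')

text \<open>Transfers the second alternative of the condition on the weights: a dummy has the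
  forward value of its child.\<close>

lemma fw_value_P'_nonzero:
  assumes "\<forall>n\<in>nodes P. fw_value C w P n \<noteq> 0" "n \<in> nodes P'"
  shows "fw_value C w P' n \<noteq> 0"
  using assms(2)
proof (cases rule: nodes_P'_cases)
  case (1 m)
  then show ?thesis
    using assms(1) by (simp add: fw_value_def node_value_even)
next
  case (2 c)
  then show ?thesis
    using assms(1) needs_dummy_nodes
    by (simp add: fw_value_def node_value_odd[simplified] node_value_even)
qed

text \<open>Copies inherit the property through \<open>scope_target\<close>; a dummy has only one
  child.\<close>

lemma smooth_P':
  assumes "smooth P"
  shows "smooth P'"
  unfolding smooth_def
proof (intro ballI allI impI)
  fix n cs \<theta> c\<^sub>1 c\<^sub>2
  assume n: "n \<in> nodes P'" "node_at P' n = Sum cs \<theta>" and c: "c\<^sub>1 \<in> ch P' n" "c\<^sub>2 \<in> ch P' n"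
  from n(1) show "scope P' c\<^sub>1 = scope P' c\<^sub>2"
  proof (cases rule: nodes_P'_cases)
    case (1 m)
    then obtain ds \<eta> where "node_at P m = Sum ds \<eta>"
      using n(2) by (cases "node_at P m") (auto simp: node_at_even)
    then have "scope P a = scope P b" if "a \<in> ch P m" "b \<in> ch P m" for a b
      using assms 1 that unfolding smooth_def by blast
    moreover obtain a b where "a \<in> ch P m" "b \<in> ch P m"
      "c\<^sub>1 = target P (node_at P m) a" "c\<^sub>2 = target P (node_at P m) b"
      using 1 c ch_even by auto
    ultimately show ?thesis
      using 1 by (metis scope_target)
  next
    case (2 b)
    then show ?thesis
      using c ch_odd[of b] by simp
  qed
qed

lemma decomposable_P':
  assumes "decomposable P"
  shows "decomposable P'"
  unfolding decomposable_def
proof (intro ballI allI impI)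
  fix n cs c\<^sub>1 c\<^sub>2
  assume n: "n \<in> nodes P'" "node_at P' n = Product cs"
    and c: "c\<^sub>1 \<in> ch P' n" "c\<^sub>2 \<in> ch P' n" "c\<^sub>1 \<noteq> c\<^sub>2"
  from n(1) show "scope P' c\<^sub>1 \<inter> scope P' c\<^sub>2 = {}"
  proof (cases rule: nodes_P'_cases)
    case (1 m)
    then obtain ds where "node_at P m = Product ds"
      using n(2) by (cases "node_at P m") (auto simp: node_at_even)
    then have "scope P a \<inter> scope P b = {}" if "a \<in> ch P m" "b \<in> ch P m" "a \<noteq> b" for a b
      using assms 1 that unfolding decomposable_def by blast
    moreover obtain a b where "a \<in> ch P m" "b \<in> ch P m"
      "c\<^sub>1 = target P (node_at P m) a" "c\<^sub>2 = target P (node_at P m) b"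
      using 1 c ch_even by auto
    ultimately show ?thesis
      using 1 c(3) by (metis scope_target)
  next
    case (2 b)
    then show ?thesis
      using c ch_odd[of b] by simp
  qed
qed

lemma alternating_P': "alternating P'"
  unfolding alternating_def
proof (clarify)
  fix m c assume e: "(m, c) \<in> edges P'" and clash: "clash (node_at P' m) (node_at P' c)"
  from e have m: "m \<in> nodes P'" "c \<in> ch P' m"
    by (simp_all add: edges_iff)
  from m(1) show False
  proof (cases rule: nodes_P'_cases)
    case (1 n)
    then obtain a where a: "a \<in> ch P n" "c = target P (node_at P n) a"
      using m ch_even by auto
    from 1(1) a(1) show ?thesis
    proof (cases rule: target_cases)
      case dummy: 1
      then show ?thesis
        using clash a(2) 1 clash_into_dummy[OF dummy(2)] node_at_odd[OF dummy(1)]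
        by (simp add: node_at_even)
    next
      case 2
      then show ?thesis
        using clash a 1 ch_in_nodes[OF 1(1) a(1)] by (simp add: node_at_even clash_convert)
    qed
  next
    case (2 b)
    then show ?thesis
      using clash m ch_odd[of b] node_at_odd[of b] clash_from_dummy needs_dummy_nodes[of b]
      by (simp add: node_at_even)
  qed
qed

section \<open>Running time with the conversion\<close>

lemma time_make_alternating: "time (make_alternating P) \<le> 50 * (pc_size P + d * C)"
proof -
  let ?ord = "val (preorder P)"
  \<comment> \<open>The worst case is a sum node: 5 units besides its children, and 10 per child,
    namely 6 for \<open>link\<close>, 3 further operations and one loop unit. The last 3 units set
    up the new root and record.\<close>
  have "time (make_alternating P) \<le>
      time (preorder P) + (1 + ((1 + (\<Sum>n\<leftarrow>?ord. (5 + 10 * length (children_of (node_at P n))) + 1)) + 3))"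
    unfolding make_alternating_def time_bind time_op val_op
  proof (intro add_left_mono add_mono time_for_each, goal_cases)
    case (1 n M)
    show ?case
    proof (cases "node_at P n")
      case (Product cs)
      let ?body = "\<lambda>c (cs', M). do {
        (c', M') \<leftarrow> link P (node_at P n) c M;
        cs'' \<leftarrow> op (c' # cs');
        ret (cs'', M')
      }"
      have "time (for_each cs ?body ([], M)) \<le> 1 + (7 + 1) * length cs"
        using time_link by (intro time_for_each_const) (auto simp: val_link split: prod.split)
      then show ?thesis
        by (simp add: Product split_beta)
    next
      case (Sum cs \<theta>)
      let ?body = "\<lambda>c (cs', \<theta>', M). do {
        (c', M') \<leftarrow> link P (node_at P n) c M;
        cs'' \<leftarrow> op (c' # cs');
        a \<leftarrow> op (\<theta> c);
        \<theta>'' \<leftarrow> op (\<theta>'(c' := a));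
        ret (cs'', \<theta>'', M')
      }"
      have "time (for_each cs ?body ([], \<lambda>_. 0, M)) \<le> 1 + (9 + 1) * length cs"
        using time_link by (intro time_for_each_const) (auto simp: val_link split: prod.split)
      then show ?thesis
        by (simp add: Sum split_beta)
    qed simp
  qed simp
  also have "(\<Sum>n\<leftarrow>?ord. (5 + 10 * length (children_of (node_at P n))) + 1) =
      (\<Sum>n\<in>nodes P. 6 + 10 * card (ch P n))"
    unfolding sum_list_preorder by (intro sum.cong) (simp_all add: length_children)
  also have "\<dots> = 6 * card (nodes P) + 10 * pc_size P"
    by (simp only: sum.distrib pc_size_eq sum_distrib_left sum_constant) simp
  finally have "time (make_alternating P) \<le> 10 + 12 * card (nodes P) + 16 * pc_size P"
    using time_preorder_le by simp
  moreover have "t \<le> 50 * (E + D)" if "t \<le> 10 + 12 * N + 16 * E" "N \<le> E + D" "1 \<le> D"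
    for t N E D :: nat
    using that by simp
  moreover have "1 \<le> d * C"
    using C_pos d_pos by (simp add: Suc_leI)
  ultimately show ?thesis
    using card_nodes_le by blast
qed

text \<open>The number of edges at most doubles, so the constants are
  \<open>210 = 50 + 2 * 80\<close> and \<open>30 = 2 * 15\<close>.\<close>

lemma time_forward_backward_any:
  "time (forward_backward_any d C w P) \<le> (210 + 30 * C) * (pc_size P + d * C)"
proof -
  interpret P': circuit d C P'
    by unfold_locales (rule is_pc_P')
  have "time (forward_backward d C w P') \<le> (80 + 15 * C) * (pc_size P' + d * C)"
    by (rule P'.time_forward_backward)
  also have "\<dots> \<le> (80 + 15 * C) * (2 * (pc_size P + d * C))"
    using pc_size_P' by (intro mult_left_mono) simp_all
  finally have "time (forward_backward_any d C w P) \<le>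
      50 * (pc_size P + d * C) + (80 + 15 * C) * (2 * (pc_size P + d * C))"
    using time_make_alternating by (simp add: forward_backward_any_def)
  then show ?thesis
    by (simp add: algebra_simps)
qed

end

lemma (in smooth_decomposable_circuit) forward_backward_any_correct:
  assumes "norm_const d C w P \<noteq> 0"
    and "(\<forall>i<d. \<forall>v<C. 0 \<le> w i v) \<or> (\<forall>n\<in>nodes P. fw_value C w P n \<noteq> 0)"
    and "i < d" "v < C"
  shows "val (forward_backward_any d C w P) i v = marginal d C (reweighted d C w P) i v"
proof -
  interpret P': alternating_circuit d C P'
    using smooth decomposable
    by unfold_locales (simp_all add: is_pc_P' smooth_P' decomposable_P' alternating_P')
  show ?thesis
    using P'.forward_backward_correct[of w i v] assms fw_value_P'_nonzero
    by (auto simp: forward_backward_any_def norm_const_P' reweighted_P')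
qed

text \<open>\<open>norm_const d C w P \<noteq> 0\<close> makes the reweighted distribution
  meaningful, and the disjunction keeps vanishing denominators harmless. \<open>K\<close> may depend
  on \<open>C\<close> only. A single input node has no edges although \<open>d * C > 0\<close>,
  whence \<open>0 < pc_size P\<close> in the last bound.\<close>

theorem theorem1:
  fixes C :: nat
  shows
    "(\<forall>d P w. is_pc d C P \<and> smooth P \<and> decomposable P \<and> norm_const d C w P \<noteq> 0 \<and>
        ((\<forall>i<d. \<forall>v<C. 0 \<le> w i v) \<or> (\<forall>n\<in>nodes P. fw_value C w P n \<noteq> 0)) \<longrightarrow>
        (\<forall>i<d. \<forall>v<C.
           val (forward_backward_any d C w P) i v = marginal d C (reweighted d C w P) i v \<and>
           (alternating P \<longrightarrow>
              val (forward_backward d C w P) i v = marginal d C (reweighted d C w P) i v))) \<and>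
     (\<exists>K. \<forall>d P w. is_pc d C P \<and> smooth P \<and> decomposable P \<longrightarrow>
        time (forward_backward_any d C w P) \<le> K * (pc_size P + d * C) \<and>
        (alternating P \<longrightarrow> time (forward_backward d C w P) \<le> K * (pc_size P + d * C)) \<and>
        (0 < pc_size P \<longrightarrow> pc_size P + d * C \<le> K * pc_size P))"
\<comment> \<open>The constant for the algorithm with conversion is the largest of the three and
  serves for all bounds.\<close>
proof (intro conjI allI impI exI[of _ "210 + 30 * C"]; elim conjE)
  fix d P w i v
  assume "is_pc d C P" "smooth P" "decomposable P"
  then interpret smooth_decomposable_circuit d C P
    by unfold_locales
  assume *: "norm_const d C w P \<noteq> 0"
    "(\<forall>i<d. \<forall>v<C. 0 \<le> w i v) \<or> (\<forall>n\<in>nodes P. fw_value C w P n \<noteq> 0)" "i < d" "v < C"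
  then show "val (forward_backward_any d C w P) i v = marginal d C (reweighted d C w P) i v"
    by (rule forward_backward_any_correct)
  assume "alternating P"
  then interpret alternating_circuit d C P
    by unfold_locales
  from * show "val (forward_backward d C w P) i v = marginal d C (reweighted d C w P) i v"
    by (rule forward_backward_correct)
next
  fix d P and w :: "nat \<Rightarrow> nat \<Rightarrow> real"
  assume "is_pc d C P"
  then interpret circuit d C P
    by unfold_locales
  let ?s = "pc_size P + d * C"
  show "time (forward_backward_any d C w P) \<le> (210 + 30 * C) * ?s"
    by (rule time_forward_backward_any)
  show "time (forward_backward d C w P) \<le> (210 + 30 * C) * ?s"
    by (rule order.trans[OF time_forward_backward]) (intro mult_right_mono, simp_all)
  show "?s \<le> (210 + 30 * C) * pc_size P" if "0 < pc_size P"
    by (rule order.trans[OF size_bound[OF that]]) (intro mult_right_mono, simp_all)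
qed

end
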